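(* Consider the RMDA algorithm (defined in the context) run from a given initial point $W^0$. Assume the following. (i) $\sum_{t\ge 1} c_t=\infty$. (ii) There is $L$ such that, for $\xi\sim\mathcal D$, $f_\xi$ is almost surely differentiable with $L$-Lipschitz-continuous gradient (so $f$ is also differentiable with $L$-Lipschitz-continuous gradient). (iii) There is $C\ge 0$ such that $\mathbb E_{\xi_t\sim\mathcal D}\|\nabla f_{\xi_t}(W^{t-1})\|^2\le C$ for all $t$. (iv) $\sum_t \beta_t\eta_t\alpha_t^{-1}=\infty$, $\ \sum_t(\beta_t\eta_t\alpha_t^{-1})^2<\infty$, and $\ \|W^{t+1}-W^t\|\,(\beta_t\eta_t\alpha_t^{-1})^{-1}\to 0$ almost surely. (v) The set of stationary points $\mathcal Z:=\{W\in\mathcal E\mid 0\in\partial F(W)\}$ is nonempty. (vi) $\beta_t\alpha_t^{-1}\to 0$. Let $W^*\in\mathcal E$ and consider the event that $\{\tilde W^t\}$ converges to $W^*$. Suppose that this event has nonzero probability; that $\psi$ is prox-regular and subdifferentially continuous at $W^*$ and partly smooth at $W^*$ relative to the $\mathcal C^2$ manifold $\mathcal M$; that $\partial\psi$ is outer semicontinuous at $W^*$; and that the nondegeneracy condition $$-\nabla f(W^* )\in\operatorname{relint}\,\partial\psi(W^* )$$ holds. Then, conditional on this event, almost surely there is $T_0\ge 0$ such that $$\tilde W^t\in\mathcal M\qquad\text{for all } t\ge T_0 .$$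
   Context: **Problem.** $\mathcal E$ is a Euclidean space with inner product $\langle\cdot,\cdot\rangle$ and induced norm $\|\cdot\|$. $\mathcal D$ is a probability distribution over a space $\Omega$. For $\xi\in\Omega$, $f_\xi:\mathcal E\to\mathbb R$ is a function that is differentiable almost everywhere with gradient $\nabla f_\xi$. Put $f(W):=\mathbb E_{\xi\sim\mathcal D}[f_\xi(W)]$. The regularizer $\psi:\mathcal E\to(-\infty,\infty]$ may be nondifferentiable and nonconvex. The objective is $F:=f+\psi$. **RMDA algorithm.** Given $W^0\in\mathcal E$, learning rates $\eta_t>0$ and factors $c_t\in[0,1]$ ($t\ge 1$), set $V^0=0$, $\alpha_0=0$, and for $t=1,2,\dots$: - $\beta_t=\sqrt t$ and $\alpha_t=\alpha_{t-1}+\beta_t\eta_t$ (so $\alpha_t=\sum_{k=1}^t\beta_k\eta_k$); - draw $\xi_t\sim\mathcal D$ independently of the past and set $V^t=V^{t-1}+\beta_t\eta_t\nabla f_{\xi_t}(W^{t-1})$; - $\tilde W^t\in\operatorname{argmin}_{W}\ \langle V^t,W\rangle+\frac{\beta_t}{2}\|W-W^0\|^2+\alpha_t\psi(W)$; - $W^t=(1-c_t)W^{t-1}+c_t\tilde W^t$. $\mathbb E_{\xi_t\sim\mathcal D}$ denotes expectation over the fresh sample $\xi_t$, with $W^{t-1}$ held fixed (i.e. conditional on the past). **Variational notions.** $\partial\psi$ is the regular (Fréchet) subdifferential, and $\operatorname{relint}$ is the relative interior. $\partial\psi$ is *outer semicontinuous* at $W^*$ if $W_k\to W^*$, $U_k\in\partial\psi(W_k)$,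 $U_k\to U$ imply $U\in\partial\psi(W^* )$. $\psi$ is *partly smooth* at $W^*$ relative to a set $\mathcal M\ni W^*$ if: 1. around $W^*$, $\mathcal M$ is a $\mathcal C^2$-manifold and $\psi|_{\mathcal M}$ is $\mathcal C^2$; 2. $\psi$ is regular (finite, with the Fréchet subdifferential coinciding with the limiting Fréchet subdifferential) at all points $W\in\mathcal M$ around $W^*$, with $\partial\psi(W)\ne\emptyset$; 3. the affine span of $\partial\psi(W^* )$ is a translate of the normal space to $\mathcal M$ at $W^*$; 4. the set-valued map $\partial\psi$ is continuous at $W^*$ relative to $\mathcal M$. In this case $\mathcal M$ is called the active manifold at $W^*$. $\psi$ is *prox-regular* at $W^*$ for $V^*\in\partial\psi(W^* )$ if $\psi$ is finite at $W^*$, locally lower semicontinuous around $W^*$, and there is $\rho>0$ such that $\psi(W_1)\ge\psi(W_2)+\langle V,W_1-W_2\rangle-\frac{\rho}{2}\|W_1-W_2\|^2$ whenever $W_1,W_2$ are close to $W^*$ with $\psi(W_2)$ near $\psi(W^* )$ and $V\in\partial\psi(W_2)$ near $V^*$. It is prox-regular at $W^*$ if this holds for all $V^*\in\partial\psi(W^* )$. $\psi$ is *subdifferentially continuous* at $W^*$ if, whenever $W_t\to W^*$ and there are $V^*\in\partial\psi(W^* )$ and $V_t\in\partial\psi(W_t)$ with $V_t\to V^*$, one has $\psi(W_t)\to\psi(W^* )$. *)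

theory Defs
  imports "HOL-Probability.Probability"
begin

subsection \<open>Gradients\<close>

text \<open>An unspecified vector at points where \<open>f\<close> is not differentiable.\<close>

definition gradient :: "('a::real_inner \<Rightarrow> real) \<Rightarrow> 'a \<Rightarrow> 'a" where
  "gradient f x = (THE D. GDERIV f x :> D)"

lemma gradient_eqI: "GDERIV f x :> D \<Longrightarrow> gradient f x = D"
  unfolding gradient_def
proof (rule the_equality)
  fix E assume "GDERIV f x :> E" "GDERIV f x :> D"
  then have "(\<lambda>h. h \<bullet> E) = (\<lambda>h. h \<bullet> D)"
    unfolding gderiv_def by (rule has_derivative_unique)
  then show "E = D"
    by (metis vector_eq_ldot)
qed


subsection \<open>Subdifferentials of extended-real-valued functions\<close>

definition frechet_subdiff :: "('a::real_inner \<Rightarrow> ereal) \<Rightarrow> 'a \<Rightarrow> 'a set" where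
  "frechet_subdiff \<psi> x = {v. \<bar>\<psi> x\<bar> \<noteq> \<infinity> \<and>
     0 \<le> Liminf (at x) (\<lambda>y. (\<psi> y - \<psi> x - ereal (v \<bullet> (y - x))) / ereal (norm (y - x)))}"

definition limiting_subdiff :: "('a::real_inner \<Rightarrow> ereal) \<Rightarrow> 'a \<Rightarrow> 'a set" where
  "limiting_subdiff \<psi> x = {v. \<bar>\<psi> x\<bar> \<noteq> \<infinity> \<and>
     (\<exists>xs vs. xs \<longlonglongrightarrow> x \<and> (\<lambda>k. \<psi> (xs k)) \<longlonglongrightarrow> \<psi> x \<and>
        (\<forall>k. vs k \<in> frechet_subdiff \<psi> (xs k)) \<and> vs \<longlonglongrightarrow> v)}"

definition subdiff_regular_at :: "('a::real_inner \<Rightarrow> ereal) \<Rightarrow> 'a \<Rightarrow> bool" where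
  "subdiff_regular_at \<psi> x \<longleftrightarrow>
     \<bar>\<psi> x\<bar> \<noteq> \<infinity> \<and> frechet_subdiff \<psi> x = limiting_subdiff \<psi> x"


subsection \<open>Semicontinuity of set-valued maps, relative to a set (Painleve-Kuratowski)\<close>

definition outer_semicontinuous_rel ::
    "('a::topological_space \<Rightarrow> 'b::topological_space set) \<Rightarrow> 'a set \<Rightarrow> 'a \<Rightarrow> bool" where
  "outer_semicontinuous_rel S X x \<longleftrightarrow>
     (\<forall>xs us u. (\<forall>k. xs k \<in> X) \<and> xs \<longlonglongrightarrow> x \<and> (\<forall>k. us k \<in> S (xs k)) \<and> us \<longlonglongrightarrow> u
        \<longrightarrow> u \<in> S x)"

definition inner_semicontinuous_rel ::
    "('a::topological_space \<Rightarrow> 'b::topological_space set) \<Rightarrow> 'a set \<Rightarrow> 'a \<Rightarrow> bool" where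
  "inner_semicontinuous_rel S X x \<longleftrightarrow>
     (\<forall>u\<in>S x. \<forall>xs. (\<forall>k. xs k \<in> X) \<and> xs \<longlonglongrightarrow> x
        \<longrightarrow> (\<exists>us. (\<forall>\<^sub>F k in sequentially. us k \<in> S (xs k)) \<and> us \<longlonglongrightarrow> u))"

definition continuous_setmap_rel ::
    "('a::topological_space \<Rightarrow> 'b::topological_space set) \<Rightarrow> 'a set \<Rightarrow> 'a \<Rightarrow> bool" where
  "continuous_setmap_rel S X x \<longleftrightarrow>
     outer_semicontinuous_rel S X x \<and> inner_semicontinuous_rel S X x"


subsection \<open>Manifolds of class C2\<close>

definition C2_on :: "('a::real_normed_vector \<Rightarrow> 'b::real_normed_vector) \<Rightarrow> 'a set \<Rightarrow> bool" where
  "C2_on f U \<longleftrightarrow>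
     (\<exists>(f' :: 'a \<Rightarrow> 'a \<Rightarrow>\<^sub>L 'b) (f'' :: 'a \<Rightarrow> 'a \<Rightarrow>\<^sub>L ('a \<Rightarrow>\<^sub>L 'b)).
        (\<forall>x\<in>U. (f has_derivative blinfun_apply (f' x)) (at x)) \<and>
        (\<forall>x\<in>U. (f' has_derivative blinfun_apply (f'' x)) (at x)) \<and>
        continuous_on U f'')"

text \<open>Around \<open>x\<close>, the set \<open>M\<close> is cut out by finitely many C2 equations with linearly independent
  gradients. Independence is required at \<open>x\<close> only; by continuity it persists nearby.\<close>

definition C2_manifold_around :: "'a::euclidean_space set \<Rightarrow> 'a \<Rightarrow> bool" where
  "C2_manifold_around M x \<longleftrightarrow> x \<in> M \<and>
     (\<exists>(m::nat) (g :: nat \<Rightarrow> 'a \<Rightarrow> real) U. open U \<and> x \<in> U \<and>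
        (\<forall>i<m. C2_on (g i) U) \<and>
        M \<inter> U = {y\<in>U. \<forall>i<m. g i y = 0} \<and>
        inj_on (\<lambda>i. gradient (g i) x) {..<m} \<and>
        independent ((\<lambda>i. gradient (g i) x) ` {..<m}))"

text \<open>The restriction of \<open>\<psi>\<close> to \<open>M\<close> is C2 around \<open>x\<close>: it locally extends to a C2 function
  on an open subset of the ambient space.\<close>

definition C2_restriction_around :: "('a::euclidean_space \<Rightarrow> ereal) \<Rightarrow> 'a set \<Rightarrow> 'a \<Rightarrow> bool" where
  "C2_restriction_around \<psi> M x \<longleftrightarrow>
     (\<exists>U (h :: 'a \<Rightarrow> real). open U \<and> x \<in> U \<and> C2_on h U \<and> (\<forall>y\<in>M \<inter> U. \<psi> y = ereal (h y)))"

definition tangent_space :: "'a::euclidean_space set \<Rightarrow> 'a \<Rightarrow> 'a set" where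
  "tangent_space M x =
     {v. \<exists>(\<gamma> :: real \<Rightarrow> 'a) \<epsilon>. 0 < \<epsilon> \<and> \<gamma> C1_differentiable_on {-\<epsilon><..<\<epsilon>} \<and>
           \<gamma> ` {-\<epsilon><..<\<epsilon>} \<subseteq> M \<and> \<gamma> 0 = x \<and> (\<gamma> has_vector_derivative v) (at 0)}"

definition normal_space :: "'a::euclidean_space set \<Rightarrow> 'a \<Rightarrow> 'a set" where
  "normal_space M x = orthogonal_comp (tangent_space M x)"


subsection \<open>Partial smoothness, prox-regularity, subdifferential continuity\<close>

definition partly_smooth :: "('a::euclidean_space \<Rightarrow> ereal) \<Rightarrow> 'a set \<Rightarrow> 'a \<Rightarrow> bool" where
  "partly_smooth \<psi> M x \<longleftrightarrow>
     C2_manifold_around M x \<and> C2_restriction_around \<psi> M x \<and>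
     (\<exists>U. open U \<and> x \<in> U \<and>
        (\<forall>y\<in>M \<inter> U. subdiff_regular_at \<psi> y \<and> frechet_subdiff \<psi> y \<noteq> {})) \<and>
     (\<exists>a. affine hull (frechet_subdiff \<psi> x) = (\<lambda>n. a + n) ` normal_space M x) \<and>
     continuous_setmap_rel (frechet_subdiff \<psi>) M x"

text \<open>Local lower semicontinuity in the sense of Rockafellar and Wets, \<open>Variational Analysis\<close>,
  Definition 1.33; it is implied by lower semicontinuity on a neighbourhood of \<open>x\<close>.\<close>

definition locally_lsc_at :: "('a::metric_space \<Rightarrow> ereal) \<Rightarrow> 'a \<Rightarrow> bool" where
  "locally_lsc_at \<psi> x \<longleftrightarrow>
     (\<exists>\<epsilon>>0. \<forall>a. a \<le> \<psi> x + ereal \<epsilon> \<longrightarrow> closed {y \<in> cball x \<epsilon>. \<psi> y \<le> a})"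

definition prox_regular_at_for :: "('a::real_inner \<Rightarrow> ereal) \<Rightarrow> 'a \<Rightarrow> 'a \<Rightarrow> bool" where
  "prox_regular_at_for \<psi> x v \<longleftrightarrow>
     \<bar>\<psi> x\<bar> \<noteq> \<infinity> \<and> locally_lsc_at \<psi> x \<and>
     (\<exists>\<rho>>0. \<exists>\<epsilon>>0. \<forall>y z w.
        dist y x < \<epsilon> \<and> dist z x < \<epsilon> \<and> \<bar>\<psi> z - \<psi> x\<bar> < ereal \<epsilon> \<and>
        w \<in> frechet_subdiff \<psi> z \<and> dist w v < \<epsilon>
        \<longrightarrow> \<psi> y \<ge> \<psi> z + ereal (w \<bullet> (y - z)) - ereal (\<rho> / 2 * (norm (y - z))\<^sup>2))"

definition prox_regular_at :: "('a::real_inner \<Rightarrow> ereal) \<Rightarrow> 'a \<Rightarrow> bool" where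
  "prox_regular_at \<psi> x \<longleftrightarrow> (\<forall>v\<in>frechet_subdiff \<psi> x. prox_regular_at_for \<psi> x v)"

definition subdiff_continuous_at :: "('a::real_inner \<Rightarrow> ereal) \<Rightarrow> 'a \<Rightarrow> bool" where
  "subdiff_continuous_at \<psi> x \<longleftrightarrow>
     (\<forall>xs vs v. xs \<longlonglongrightarrow> x \<and> v \<in> frechet_subdiff \<psi> x \<and>
        (\<forall>k. vs k \<in> frechet_subdiff \<psi> (xs k)) \<and> vs \<longlonglongrightarrow> v
        \<longrightarrow> (\<lambda>k. \<psi> (xs k)) \<longlonglongrightarrow> \<psi> x)"


subsection \<open>The RMDA algorithm\<close>

definition expected_loss :: "'w measure \<Rightarrow> ('w \<Rightarrow> 'a \<Rightarrow> real) \<Rightarrow> 'a \<Rightarrow> real" where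
  "expected_loss D f W = (\<integral>\<xi>. f \<xi> W \<partial>D)"

definition rmda_beta :: "nat \<Rightarrow> real" where
  "rmda_beta t = sqrt (real t)"

primrec rmda_alpha :: "(nat \<Rightarrow> real) \<Rightarrow> nat \<Rightarrow> real" where
  "rmda_alpha \<eta> 0 = 0"
| "rmda_alpha \<eta> (Suc t) = rmda_alpha \<eta> t + rmda_beta (Suc t) * \<eta> (Suc t)"

definition rmda_ratio :: "(nat \<Rightarrow> real) \<Rightarrow> nat \<Rightarrow> real" where
  "rmda_ratio \<eta> t = rmda_beta t * \<eta> t * inverse (rmda_alpha \<eta> t)"

text \<open>One sample path: \<open>s\<close> is the sequence of drawn samples and \<open>V\<close>, \<open>Wt\<close>, \<open>W\<close> are the
  sequences of dual averages, subproblem solutions and iterates. The values \<open>s 0\<close> and \<open>Wt 0\<close>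
  play no role. Ties in the subproblem may be broken arbitrarily.\<close>

definition rmda_path ::
    "('w \<Rightarrow> 'a::euclidean_space \<Rightarrow> real) \<Rightarrow> ('a \<Rightarrow> ereal) \<Rightarrow> 'a \<Rightarrow> (nat \<Rightarrow> real) \<Rightarrow> (nat \<Rightarrow> real)
      \<Rightarrow> (nat \<Rightarrow> 'w) \<Rightarrow> (nat \<Rightarrow> 'a) \<Rightarrow> (nat \<Rightarrow> 'a) \<Rightarrow> (nat \<Rightarrow> 'a) \<Rightarrow> bool" where
  "rmda_path f \<psi> W0 \<eta> c s V Wt W \<longleftrightarrow>
     V 0 = 0 \<and> W 0 = W0 \<and>
     (\<forall>t\<ge>1.
        V t = V (t - 1) + (rmda_beta t * \<eta> t) *\<^sub>R gradient (f (s t)) (W (t - 1)) \<and>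
        is_arg_min
          (\<lambda>X. ereal (V t \<bullet> X + rmda_beta t / 2 * (norm (X - W0))\<^sup>2)
                + ereal (rmda_alpha \<eta> t) * \<psi> X)
          (\<lambda>X. True) (Wt t) \<and>
        W t = (1 - c t) *\<^sub>R W (t - 1) + c t *\<^sub>R Wt t)"

text \<open>Each \<open>\<xi> t\<close> has law \<open>D\<close> and is independent of the past, i.e. of the sigma-algebra generated
  by the earlier samples and the earlier (possibly randomly tie-broken) subproblem solutions;
  with a deterministic starting point these determine all earlier quantities of the algorithm.\<close>

definition fresh_samples ::
    "'s measure \<Rightarrow> 'w measure \<Rightarrow> (nat \<Rightarrow> 's \<Rightarrow> 'w) \<Rightarrow> (nat \<Rightarrow> 's \<Rightarrow> 'a::euclidean_space) \<Rightarrow> bool" where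
  "fresh_samples P D \<xi> Wt \<longleftrightarrow>
     (\<forall>t\<ge>1.
        \<xi> t \<in> measurable P D \<and> distr P D (\<xi> t) = D \<and>
        prob_space.indep_set P
          (sets (vimage_algebra (space P) (\<xi> t) D))
          (sets (vimage_algebra (space P) (\<lambda>\<omega>. \<lambda>k\<in>{1..<t}. (\<xi> k \<omega>, Wt k \<omega>))
                   (PiM {1..<t} (\<lambda>_. D \<Otimes>\<^sub>M borel)))))"

end

theory Submission
  imports Defs
begin

text \<open>On the event that the subproblem solutions converge to \<open>Wstar\<close>, the averaged iterates \<open>W t\<close>
  converge to \<open>Wstar\<close> as well. The ratio \<open>V t / \<alpha> t\<close> is a weighted average of stochastic gradients
  taken along \<open>W t\<close>. Its noise is a martingale transform with square-summable weights, hence an almost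
  surely convergent series, so \<open>V t / \<alpha> t\<close> tends to the gradient of the expected loss at \<open>Wstar\<close>.
  The optimality condition of the subproblem then provides subgradients of \<open>\<psi>\<close> at \<open>Wt t\<close> that converge
  to a relative interior point of the subdifferential at \<open>Wstar\<close>. If \<open>Wt t\<close> were off the manifold
  infinitely often, compare it with a point of the manifold that differs from it by a
  normal vector: partial smoothness gives nearby subgradients there that are tilted towards this
  normal direction, and prox-regularity used at both points contradicts the tilt.\<close>

text \<open>Conditioning on the convergence event would spoil the independence of the fresh samples.
  The stochastic part therefore lives on the whole probability space: the conditional second moment
  bound \<open>C\<close> makes the noise bounded in mean square, and its weighted series converges
  almost surely without any reference to the event. Convergence of \<open>Wt\<close> is used
  afterwards, path by path, and the event enters only as the premise of an implication. The ratios
  play two roles: their divergent sum makes the average forget its past, their square summability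
  controls the noise. The proximal term of the subproblem adds only
  \<open>rmda_beta t / rmda_alpha \<eta> t\<close> times a convergent sequence to the subgradient,
  so it disappears in the limit. On the geometric side the contradiction is quantitative: adding the
  two prox-regularity inequalities bounds the difference of the subgradients along the unit normal
  direction by \<rho> times the distance of the two points, which tends to zero, whereas the tilt
  keeps its limit at a fixed positive length \<delta>.\<close>

section \<open>Running averages and gradient vectors\<close>

text \<open>Each step multiplies the inherited error by \<open>1 - r n\<close>, which is at most
  \<open>exp (- r n)\<close>; divergence of the sum of \<open>r\<close> makes the accumulated factor
  vanish. Late inputs contribute at most \<epsilon>/2 because the weights are convex. It serves both
  for \<open>W\<close>, with weights \<open>c\<close>, and for the scaled dual average, with weights
  \<open>rmda_ratio\<close>.\<close>

lemma convex_average_tendsto: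
  fixes z u :: "nat \<Rightarrow> 'a::real_normed_vector"
  assumes z: "\<And>n. z (Suc n) = (1 - r n) *\<^sub>R z n + r n *\<^sub>R u n"
    and r: "\<And>n. 0 \<le> r n" "\<And>n. r n \<le> 1"
    and div: "filterlim (\<lambda>n. \<Sum>k<n. r k) at_top sequentially"
    and u: "u \<longlonglongrightarrow> l"
  shows "z \<longlonglongrightarrow> l"
proof (rule LIMSEQ_I)
  fix \<epsilon> :: real assume e: "0 < \<epsilon>"
  obtain N where N: "\<And>n. n \<ge> N \<Longrightarrow> norm (u n - l) < \<epsilon> / 2"
    using LIMSEQ_D[OF u, of "\<epsilon> / 2"] e by auto
  define K where "K = norm (z N - l)"
  have step: "norm (z (Suc n) - l) \<le> (1 - r n) * norm (z n - l) + r n * norm (u n - l)" for n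
  proof -
    have "z (Suc n) - l = (1 - r n) *\<^sub>R (z n - l) + r n *\<^sub>R (u n - l)"
      unfolding z by (simp add: algebra_simps)
    then show ?thesis
      using norm_triangle_ineq[of "(1 - r n) *\<^sub>R (z n - l)" "r n *\<^sub>R (u n - l)"] r[of n] by simp
  qed
  have bd: "norm (z (N + n) - l) \<le> \<epsilon> / 2 + K * exp (- (\<Sum>k=N..<N+n. r k))" for n
  proof (induction n)
    case 0 then show ?case using e by (simp add: K_def)
  next
    case (Suc n)
    define x where "x = exp (- (\<Sum>k=N..<N+n. r k))"
    have "norm (z (N + Suc n) - l) \<le> (1 - r (N+n)) * (\<epsilon> / 2 + K * x) + r (N+n) * (\<epsilon> / 2)"
      using step[of "N+n"] N[of "N+n"] Suc r[of "N+n"] unfolding x_def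
      by (smt (verit) add_Suc_right le_add1 mult_left_mono)
    also have "\<dots> = \<epsilon> / 2 + K * ((1 - r (N+n)) * x)" by (simp add: algebra_simps)
    also have "\<dots> \<le> \<epsilon> / 2 + K * (exp (- r (N+n)) * x)"
      using exp_ge_add_one_self[of "- r (N+n)"] unfolding K_def x_def
      by (intro add_left_mono mult_left_mono mult_right_mono) auto
    finally show ?case by (simp add: x_def exp_add[symmetric] algebra_simps)
  qed
  have "filterlim (\<lambda>n. (\<Sum>k<n+N. r k) - (\<Sum>k<N. r k)) at_top sequentially"
    using filterlim_tendsto_add_at_top[OF tendsto_const, of "\<lambda>n. \<Sum>k<n+N. r k" sequentially "- (\<Sum>k<N. r k)"]
      filterlim_compose[OF div filterlim_add_const_nat_at_top[of N]] by (simp add: o_def)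
  moreover have "(\<Sum>k<n+N. r k) - (\<Sum>k<N. r k) = (\<Sum>k=N..<N+n. r k)" for n
    using sum_diff_nat_ivl[of 0 N "N + n" r] by (simp add: lessThan_atLeast0 add.commute)
  ultimately have "filterlim (\<lambda>n. \<Sum>k=N..<N+n. r k) at_top sequentially" by simp
  then have "(\<lambda>n. exp (- (\<Sum>k=N..<N+n. r k))) \<longlonglongrightarrow> 0"
    by (intro filterlim_compose[OF exp_at_bot] filterlim_compose[OF filterlim_uminus_at_bot_at_top])
  from tendsto_mult_left[OF this, of K] have "(\<lambda>n. K * exp (- (\<Sum>k=N..<N+n. r k))) \<longlonglongrightarrow> 0" by simp
  from LIMSEQ_D[OF this, of "\<epsilon>/2"] e obtain N' where
    N': "\<And>n. n \<ge> N' \<Longrightarrow> K * exp (- (\<Sum>k=N..<N+n. r k)) < \<epsilon> / 2"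
    by fastforce
  have "norm (z n - l) < \<epsilon>" if "n \<ge> N + N'" for n
    using bd[of "n - N"] N'[of "n - N"] that by (simp add: le_diff_conv2)
  then show "\<exists>no. \<forall>n\<ge>no. norm (z n - l) < \<epsilon>" by blast
qed

text \<open>Riesz representation in coordinates: the representing vector has the values of the
  derivative on \<open>Basis\<close> as its coordinates.\<close>

lemma differentiable_imp_gderiv_gradient:
  fixes f :: "'a::euclidean_space \<Rightarrow> real"
  assumes "f differentiable (at x)"
  shows "GDERIV f x :> gradient f x"
proof -
  obtain f' where f': "(f has_derivative f') (at x)" using assms by (auto simp: differentiable_def)
  interpret bounded_linear f' using f' by (rule has_derivative_bounded_linear)
  have "f' h = h \<bullet> (\<Sum>b\<in>Basis. f' b *\<^sub>R b)" for h
  proof -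
    have "f' h = f' (\<Sum>b\<in>Basis. (h \<bullet> b) *\<^sub>R b)" by (simp add: euclidean_representation)
    also have "\<dots> = h \<bullet> (\<Sum>b\<in>Basis. f' b *\<^sub>R b)"
      by (simp add: sum scale inner_sum_right mult.commute)
    finally show ?thesis .
  qed
  then have "f' = (\<lambda>h. h \<bullet> (\<Sum>b\<in>Basis. f' b *\<^sub>R b))" by blast
  then have "GDERIV f x :> (\<Sum>b\<in>Basis. f' b *\<^sub>R b)" using f' by (simp add: gderiv_def)
  with gradient_eqI[OF this] show ?thesis by simp
qed

subsection \<open>Variational analysis\<close>

text \<open>A quadratic error divided by \<open>norm (y - x)\<close> is linear in the distance, so
  the difference quotient is bounded below by a function that tends to 0.\<close>

lemma frechet_subdiff_proximalI:
  fixes \<psi> :: "'a::real_inner \<Rightarrow> ereal"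
  assumes fin: "\<psi> x = ereal a"
    and ge: "\<And>y. \<psi> y \<ge> ereal (a + v \<bullet> (y - x) - \<rho> * (norm (y - x))\<^sup>2)"
  shows "v \<in> frechet_subdiff \<psi> x"
proof -
  have *: "ereal (- \<rho> * norm (y - x)) \<le> (\<psi> y - \<psi> x - ereal (v \<bullet> (y - x))) / ereal (norm (y - x))"
    if "y \<noteq> x" for y
  proof (cases "\<psi> y")
    case (real b)
    then have "- \<rho> * norm (y - x) * norm (y - x) \<le> b - a - v \<bullet> (y - x)"
      using ge[of y] by (simp add: power2_eq_square)
    then show ?thesis using that real fin by (simp add: pos_le_divide_eq)
  next
    case PInf
    then show ?thesis using that fin by simp
  next
    case MInf
    then show ?thesis using ge[of y] by simp
  qed
  have "((\<lambda>y. ereal (- \<rho> * norm (y - x))) \<longlongrightarrow> ereal (- \<rho> * norm (x - x))) (at x)"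
    by (intro tendsto_intros)
  then have t: "((\<lambda>y. ereal (- \<rho> * norm (y - x))) \<longlongrightarrow> 0) (at x)" by (simp add: zero_ereal_def)
  have "0 \<le> Liminf (at x) (\<lambda>y. (\<psi> y - \<psi> x - ereal (v \<bullet> (y - x))) / ereal (norm (y - x)))"
  \<comment> \<open>The type class admits the zero space, where \<open>at x\<close> is
    \<open>bot\<close> and the Liminf is infinite.\<close>
  proof (cases "at x = bot")
    case False
    have "0 = Liminf (at x) (\<lambda>y. ereal (- \<rho> * norm (y - x)))"
      using lim_imp_Liminf[OF False t] by simp
    also have "\<dots> \<le> Liminf (at x) (\<lambda>y. (\<psi> y - \<psi> x - ereal (v \<bullet> (y - x))) / ereal (norm (y - x)))"
      by (intro Liminf_mono) (use * in \<open>auto simp: eventually_at_filter\<close>)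
    finally show ?thesis .
  qed (simp add: top_ereal_def)
  then show ?thesis by (simp add: frechet_subdiff_def fin)
qed

text \<open>The smooth part is quadratic, so its expansion around \<open>x\<close> is exact.
  Minimality then becomes a proximal subgradient inequality for \<psi> whose modulus is \<beta>/2
  divided by \<alpha>.\<close>

lemma regularized_argmin_subgradient:
  fixes \<psi> :: "'a::euclidean_space \<Rightarrow> ereal"
  assumes min: "is_arg_min (\<lambda>X. ereal (V \<bullet> X + \<beta> / 2 * (norm (X - W0))\<^sup>2) + ereal \<alpha> * \<psi> X) (\<lambda>X. True) x"
    and \<alpha>: "\<alpha> > 0" and nm: "\<And>X. \<psi> X \<noteq> -\<infinity>" and fin: "\<bar>\<psi> X0\<bar> \<noteq> \<infinity>"
  shows "- ((V + \<beta> *\<^sub>R (x - W0)) /\<^sub>R \<alpha>) \<in> frechet_subdiff \<psi> x"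
proof -
  let ?q = "\<lambda>X. V \<bullet> X + \<beta> / 2 * (norm (X - W0))\<^sup>2"
  have le: "ereal (?q x) + ereal \<alpha> * \<psi> x \<le> ereal (?q y) + ereal \<alpha> * \<psi> y" for y
    using min unfolding is_arg_min_def by (meson linorder_not_less)
  \<comment> \<open>Comparison with the finite point \<open>X0\<close> excludes the value infinity
    at the minimizer.\<close>
  obtain a where a: "\<psi> x = ereal a"
    using le[of X0] \<alpha> nm[of x] fin by (cases "\<psi> x"; cases "\<psi> X0") auto
  show ?thesis
  proof (rule frechet_subdiff_proximalI[where a = a and \<rho> = "\<beta> / (2 * \<alpha>)"], rule a)
    fix y
    have q: "?q y = ?q x + (V + \<beta> *\<^sub>R (x - W0)) \<bullet> (y - x) + \<beta> / 2 * (norm (y - x))\<^sup>2"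
      by (simp add: power2_norm_eq_inner algebra_simps inner_commute)
    show "\<psi> y \<ge> ereal (a + - ((V + \<beta> *\<^sub>R (x - W0)) /\<^sub>R \<alpha>) \<bullet> (y - x) - \<beta> / (2 * \<alpha>) * (norm (y - x))\<^sup>2)"
    proof (cases "\<psi> y")
      case (real b)
      define d where "d = (V + \<beta> *\<^sub>R (x - W0)) \<bullet> (y - x)"
      define s where "s = (norm (y - x))\<^sup>2"
      have "?q x + \<alpha> * a \<le> ?q y + \<alpha> * b" using le[of y] real a by simp
      then have "\<alpha> * (a - b) \<le> d + \<beta> / 2 * s"
        unfolding q d_def[symmetric] s_def[symmetric] by (simp add: algebra_simps)
      then have "a - b \<le> (d + \<beta> / 2 * s) / \<alpha>" using \<alpha> by (simp add: pos_le_divide_eq mult.commute)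
      then have "a + - (inverse \<alpha> * d) - \<beta> / (2 * \<alpha>) * s \<le> b"
        by (simp add: add_divide_distrib inverse_eq_divide)
      then show ?thesis
        unfolding real inner_minus_left inner_scaleR_left d_def s_def by simp
    qed (use nm in auto)
  qed
qed

lemma C2_on_differentiable:
  assumes "C2_on f U" "x \<in> U"
  shows "f differentiable (at x)"
  using assms by (auto simp: C2_on_def differentiable_def)

lemma C2_on_continuous_on: "C2_on f U \<Longrightarrow> continuous_on U f"
  by (intro differentiable_imp_continuous_on)
    (auto simp: differentiable_on_def intro: differentiable_at_withinI C2_on_differentiable)

text \<open>A substitute for the nearest-point projection onto \<open>M\<close>: moving from \<open>x\<close> along the span \<open>N\<close>
  of the constraint gradients at the base point makes the residual lie in the normal space exactly,
  so no Lagrange multiplier argument is needed.\<close>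

lemma C2_manifold_normal_projection:
  fixes M :: "'a::euclidean_space set"
  assumes M: "C2_manifold_around M x"
  obtains N where "subspace N" "N \<subseteq> normal_space M x"
    "\<And>X. open X \<Longrightarrow> x \<in> X \<Longrightarrow> \<forall>\<^sub>F x' in nhds x. \<exists>y\<in>M \<inter> X. x' - y \<in> N"
proof -
  obtain m :: nat and g :: "nat \<Rightarrow> 'a \<Rightarrow> real" and U where U: "open U" "x \<in> U" "x \<in> M"
    and C2: "\<And>i. i < m \<Longrightarrow> C2_on (g i) U" and MU: "M \<inter> U = {y\<in>U. \<forall>i<m. g i y = 0}"
    and inj: "inj_on (\<lambda>i. gradient (g i) x) {..<m}"
    and ind: "independent ((\<lambda>i. gradient (g i) x) ` {..<m})"
    using M unfolding C2_manifold_around_def by blast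
  define G where "G i = gradient (g i) x" for i
  define N where "N = span (G ` {..<m})"
  have der: "(g i has_derivative (\<lambda>h. h \<bullet> G i)) (at x)" if "i < m" for i
    using differentiable_imp_gderiv_gradient[OF C2_on_differentiable[OF C2[OF that] U(2)]]
    by (simp add: G_def gderiv_def)
  \<comment> \<open>Independence is given for the set of gradients; injectivity transfers it to the
    indexed family, so that coefficients can be read off index by index.\<close>
  have coeff0: "\<forall>i<m. a i = 0" if "(\<Sum>i<m. a i *\<^sub>R G i) = 0" for a
  proof -
    have i: "inj_on G {..<m}" using inj by (simp add: G_def[abs_def])
    have "(\<Sum>v\<in>G ` {..<m}. a (the_inv_into {..<m} G v) *\<^sub>R v) = 0"
      using that by (simp add: sum.reindex[OF i] the_inv_into_f_f[OF i])
    moreover have "independent (G ` {..<m})" using ind by (simp add: G_def[abs_def])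
    ultimately have "\<forall>v\<in>G ` {..<m}. a (the_inv_into {..<m} G v) = 0"
      by (intro ballI independentD[where s = "G ` {..<m}" and u = "\<lambda>v. a (the_inv_into {..<m} G v)"]) auto
    then show ?thesis using the_inv_into_f_f[OF i] by auto
  qed
  have subN: "subspace N" by (simp add: N_def)
  have normal: "N \<subseteq> normal_space M x"
  proof -
    \<comment> \<open>Along a curve in \<open>M\<close> the function \<open>g i\<close> vanishes
      near parameter 0, so the chain rule makes its gradient orthogonal to the velocity.\<close>
    have "G i \<in> normal_space M x" if i: "i < m" for i
      unfolding normal_space_def orthogonal_comp_def tangent_space_def
    proof (clarsimp simp: orthogonal_def)
      fix v and \<gamma> :: "real \<Rightarrow> 'a" and \<epsilon> :: real
      assume e: "0 < \<epsilon>" and im: "\<gamma> ` {-\<epsilon><..<\<epsilon>} \<subseteq> M" and x: "x = \<gamma> 0"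
        and v: "(\<gamma> has_vector_derivative v) (at 0)"
      have "isCont \<gamma> 0" using v by (rule has_vector_derivative_continuous)
      then have "\<forall>\<^sub>F s in at 0. \<gamma> s \<in> U"
        using U x by (auto simp: isCont_def topological_tendstoD)
      moreover have "\<forall>\<^sub>F s in at 0. s \<in> {-\<epsilon><..<\<epsilon>}"
        by (intro eventually_at_in_open') (use e in auto)
      ultimately have ev: "\<forall>\<^sub>F s in at 0. g i (\<gamma> s) = 0"
        by eventually_elim (use im MU i in blast)
      have x0: "g i (\<gamma> 0) = 0" using MU U i x by blast
      have "((\<lambda>s. g i (\<gamma> s)) has_derivative (\<lambda>s. (s *\<^sub>R v) \<bullet> G i)) (at 0)"
        using has_derivative_compose[OF v[unfolded has_vector_derivative_def]] der[OF i] x by blast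
      moreover have "((\<lambda>s. g i (\<gamma> s)) has_derivative (\<lambda>s. 0)) (at 0)"
        by (rule has_derivative_transform_eventually[OF has_derivative_const[of "0::real"]])
           (use ev x0 in \<open>auto elim: eventually_mono\<close>)
      ultimately have "(\<lambda>s. (s *\<^sub>R v) \<bullet> G i) = (\<lambda>s. 0)" by (rule has_derivative_unique)
      from fun_cong[OF this, of 1] show "v \<bullet> G i = 0" by simp
    qed
    then show ?thesis
      unfolding N_def normal_space_def by (intro span_minimal subspace_orthogonal_comp) auto
  qed
  obtain B where B: "B \<subseteq> N" "pairwise orthogonal B" "\<And>v. v \<in> B \<Longrightarrow> norm v = 1"
      "independent B" "card B = dim N" "span B = N"
    using orthonormal_basis_subspace[OF subN] by blast
  have finB: "finite B" using B(4) by (rule independent_imp_finite)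
  \<comment> \<open>The orthogonal projection onto the complement of \<open>N\<close>, written in an
    orthonormal basis of \<open>N\<close>.\<close>
  define Q where "Q h = h - (\<Sum>b\<in>B. (h \<bullet> b) *\<^sub>R b)" for h :: 'a
  have linQ: "bounded_linear Q"
    unfolding Q_def by (intro bounded_linear_intros)
  have QN: "h - Q h \<in> N" for h
    unfolding Q_def using B(1) subN by (auto intro!: subspace_sum subspace_scale)
  have Qorth: "Q h \<bullet> v = 0" if "v \<in> N" for h v
  proof -
    have "Q h \<bullet> b = 0" if b: "b \<in> B" for b
    proof -
      have "(\<Sum>c\<in>B. (h \<bullet> c) * (c \<bullet> b)) = (\<Sum>c\<in>B. if c = b then h \<bullet> b else 0)"
        using B(2,3) b by (intro sum.cong) (auto simp: pairwise_def orthogonal_def norm_eq_1)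
      then show ?thesis using finB b by (simp add: Q_def inner_diff_left inner_sum_left)
    qed
    then have "orthogonal (Q h) v"
      using orthogonal_to_span[of v B "Q h"] that B(6) by (simp add: orthogonal_def)
    then show ?thesis by (simp add: orthogonal_def)
  qed
  have split0: "p = p' \<and> n = n'" if "p + n = p' + n'" "n \<in> N" "n' \<in> N" "p = Q h" "p' = Q h'" for p n p' n' h h'
  proof -
    have "n' - n \<in> N" using that subN by (auto intro: subspace_diff)
    then have "(p - p') \<bullet> (n' - n) = 0" using Qorth that(4,5) by (simp add: inner_diff_left)
    moreover have "p - p' = n' - n" using that(1) by (simp add: algebra_simps)
    ultimately have "(p - p') \<bullet> (p - p') = 0" by simp
    then show ?thesis using that(1) by simp
  qed
  \<comment> \<open>Constraint values are sent into \<open>N\<close> and the remaining coordinates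
    into its complement. By uniqueness of this splitting, a solution in \<open>U\<close> of
    \<open>F y = Q x'\<close> satisfies all constraints and has the same complement part as
    \<open>x'\<close>; hence \<open>y\<close> is in \<open>M\<close> and \<open>x' - y\<close> in
    \<open>N\<close>.\<close>
  define F where "F y = Q y + (\<Sum>i<m. g i y *\<^sub>R G i)" for y
  define F' where "F' h = Q h + (\<Sum>i<m. (h \<bullet> G i) *\<^sub>R G i)" for h
  have GN: "(\<Sum>i<m. a i *\<^sub>R G i) \<in> N" for a
    unfolding N_def by (intro span_sum span_scale span_base) auto
  have linF': "linear F'"
    unfolding F'_def
    by (intro bounded_linear.linear bounded_linear_add linQ bounded_linear_intros)
  have "inj F'"
    unfolding linear_injective_0[OF linF']
  proof (intro allI impI)
    fix h assume "F' h = 0"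
    then have "Q h = Q 0 \<and> (\<Sum>i<m. (h \<bullet> G i) *\<^sub>R G i) = 0"
      using GN linQ
      by (intro split0[where h = h and h' = 0])
        (auto simp: F'_def linear_0[OF bounded_linear.linear[OF linQ]] subspace_0[OF subN])
    then have 1: "Q h = 0" and "\<forall>i<m. h \<bullet> G i = 0"
      using coeff0[of "\<lambda>i. h \<bullet> G i"] by (auto simp: linear_0[OF bounded_linear.linear[OF linQ]])
    then have 2: "v \<in> N \<Longrightarrow> orthogonal h v" for v
      using orthogonal_to_span[of v "G ` {..<m}" h] unfolding N_def by (auto simp: orthogonal_def)
    have "h \<in> N" using QN[of h] 1 by simp
    from 2[OF this] show "h = 0" by (simp add: orthogonal_def)
  qed
  then obtain F'' where F'': "linear F''" "F' \<circ> F'' = id"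
    using linear_injective_isomorphism[OF linF'] by (auto simp: fun_eq_iff)
  have derF: "(F has_derivative F') (at x)"
    unfolding F_def F'_def
    by (intro has_derivative_add has_derivative_sum
        has_derivative_scaleR_left der bounded_linear_imp_has_derivative linQ) auto
  have contF: "continuous_on U F"
    unfolding F_def
    by (intro continuous_intros linear_continuous_on linQ C2_on_continuous_on C2) auto
  have "\<forall>\<^sub>F x' in nhds x. \<exists>y\<in>M \<inter> X. x' - y \<in> N" if X: "open X" "x \<in> X" for X
  proof -
    \<comment> \<open>Continuity on \<open>U\<close> and an invertible derivative at the single
      point \<open>x\<close> give local surjectivity. Since the constraints vanish at
      \<open>x\<close>, the value \<open>F x\<close> is \<open>Q x\<close>, and \<open>Q x'\<close>
      is attained for all \<open>x'\<close> near \<open>x\<close>.\<close>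
    have "F x \<in> interior (F ` (U \<inter> X))"
      by (rule sussmann_open_mapping[OF U(1) contF U(2) derF _ F''(2)])
        (use F''(1) U X in \<open>auto simp: linear_linear interior_open open_Int\<close>)
    moreover have "\<forall>i<m. g i x = 0" using MU U by blast
    then have "F x = Q x" by (simp add: F_def)
    moreover have "(Q \<longlongrightarrow> Q x) (nhds x)"
      using linear_continuous_at[OF linQ, of x] by (simp add: continuous_at tendsto_at_iff_tendsto_nhds)
    ultimately have "\<forall>\<^sub>F x' in nhds x. Q x' \<in> interior (F ` (U \<inter> X))"
      using topological_tendstoD open_interior by fastforce
    then show ?thesis
    proof (rule eventually_mono)
      fix x' assume "Q x' \<in> interior (F ` (U \<inter> X))"
      then obtain y where y: "y \<in> U" "y \<in> X" "Q x' = F y" using interior_subset by blast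
      then have "Q x' = Q y \<and> 0 = (\<Sum>i<m. g i y *\<^sub>R G i)"
        using GN subspace_0[OF subN] by (intro split0[where h = x' and h' = y]) (auto simp: F_def)
      then have Qe: "Q x' = Q y" and "y \<in> M"
        using coeff0[of "\<lambda>i. g i y"] MU y by auto
      moreover have "x' - y = (x' - Q x') - (y - Q y)" using Qe by simp
      then have "x' - y \<in> N" using QN subN by (metis subspace_diff)
      ultimately show "\<exists>y\<in>M \<inter> X. x' - y \<in> N" using y by blast
    qed
  qed
  then show ?thesis using that subN normal by blast
qed

text \<open>The affine hull of the subdifferential is parallel to the normal space, so relative
  interiority leaves room to tilt \<open>u\<close> in every normal direction. Prox-regularity makes
  nearby subgradients almost monotone, which forbids such a tilt along offsets whose length tends to
  zero. The assumption \<open>vals\<close> brings the points \<open>xs k\<close> into the range of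
  values where prox-regularity applies.\<close>

lemma partly_smooth_identification:
  fixes \<psi> :: "'a::euclidean_space \<Rightarrow> ereal"
  assumes ps: "partly_smooth \<psi> M x"
    and pr: "prox_regular_at_for \<psi> x u"
    and ri: "u \<in> rel_interior (frechet_subdiff \<psi> x)"
    and xs: "xs \<longlonglongrightarrow> x" and us: "us \<longlonglongrightarrow> u" and sub: "\<And>k. us k \<in> frechet_subdiff \<psi> (xs k)"
    and vals: "(\<lambda>k. \<psi> (xs k)) \<longlonglongrightarrow> \<psi> x"
  shows "\<forall>\<^sub>F k in sequentially. xs k \<in> M"
proof (rule ccontr)
  assume "\<not> ?thesis"
  then have freq: "\<exists>\<^sub>F k in sequentially. xs k \<notin> M" by (simp add: not_eventually)
  have M: "C2_manifold_around M x" using ps by (simp add: partly_smooth_def)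
  have xM: "x \<in> M" using M by (simp add: C2_manifold_around_def)
  obtain N where N: "subspace N" "N \<subseteq> normal_space M x"
    and proj: "\<And>X. open X \<Longrightarrow> x \<in> X \<Longrightarrow> \<forall>\<^sub>F x' in nhds x. \<exists>y\<in>M \<inter> X. x' - y \<in> N"
    using C2_manifold_normal_projection[OF M] by blast
  have fin: "\<bar>\<psi> x\<bar> \<noteq> \<infinity>" using pr by (simp add: prox_regular_at_for_def)
  obtain \<rho> \<epsilon> where \<rho>: "\<rho> > 0" and \<epsilon>: "\<epsilon> > 0"
    and prox: "\<forall>y z w. dist y x < \<epsilon> \<and> dist z x < \<epsilon> \<and> \<bar>\<psi> z - \<psi> x\<bar> < ereal \<epsilon> \<and>
        w \<in> frechet_subdiff \<psi> z \<and> dist w u < \<epsilon> \<longrightarrow>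
        \<psi> y \<ge> \<psi> z + ereal (w \<bullet> (y - z)) - ereal (\<rho> / 2 * (norm (y - z))\<^sup>2)"
    using pr unfolding prox_regular_at_for_def by blast
  have "C2_restriction_around \<psi> M x" using ps by (simp add: partly_smooth_def)
  then obtain U h where U: "open U" "x \<in> U" and h: "C2_on h U" "\<forall>y\<in>M \<inter> U. \<psi> y = ereal (h y)"
    unfolding C2_restriction_around_def by (elim exE conjE) (rule that)
  obtain a where aff: "affine hull (frechet_subdiff \<psi> x) = (\<lambda>n. a + n) ` normal_space M x"
    using ps unfolding partly_smooth_def by blast
  have inner: "inner_semicontinuous_rel (frechet_subdiff \<psi>) M x"
    using ps unfolding partly_smooth_def continuous_setmap_rel_def by blast

  \<comment> \<open>Diagonal choice: an index beyond \<open>n\<close> and a companion point on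
    \<open>M\<close> within \<open>1 / Suc n\<close> of \<open>x\<close>, so both selected sequences
    converge to \<open>x\<close>.\<close>
  have "\<exists>k>n. xs k \<notin> M \<and> (\<exists>y\<in>M \<inter> ball x (1 / Suc n). xs k - y \<in> N)" for n
  proof -
    have "\<forall>\<^sub>F k in sequentially. \<exists>y\<in>M \<inter> ball x (1 / Suc n). xs k - y \<in> N"
      by (rule eventually_compose_filterlim[OF proj xs]) auto
    then have "\<forall>\<^sub>F k in sequentially. xs k \<notin> M \<longrightarrow>
        n < k \<and> xs k \<notin> M \<and> (\<exists>y\<in>M \<inter> ball x (1 / Suc n). xs k - y \<in> N)"
      using eventually_gt_at_top[of n] by eventually_elim simp
    from frequently_rev_mp[OF freq this] show ?thesis by (blast dest: frequently_ex)
  qed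
  then have "\<exists>k y. n < k \<and> xs k \<notin> M \<and> y \<in> M \<and> dist x y < 1 / Suc n \<and> xs k - y \<in> N" for n
    by fastforce
  then obtain \<kappa> y where "\<forall>n. n < \<kappa> n \<and> xs (\<kappa> n) \<notin> M \<and> y n \<in> M \<and> dist x (y n) < 1 / Suc n \<and> xs (\<kappa> n) - y n \<in> N"
    by metis
  then have \<kappa>: "\<And>n. \<kappa> n > n" "\<And>n. xs (\<kappa> n) \<notin> M"
    and y: "\<And>n. y n \<in> M" "\<And>n. dist x (y n) < 1 / Suc n" "\<And>n. xs (\<kappa> n) - y n \<in> N"
    by blast+
  have \<kappa>lim: "filterlim \<kappa> at_top sequentially"
    by (rule filterlim_at_top_mono[OF filterlim_ident]) (intro always_eventually allI less_imp_le \<kappa>(1))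
  have ylim: "y \<longlonglongrightarrow> x"
  proof (rule metric_tendsto_imp_tendsto[OF LIMSEQ_inverse_real_of_nat])
    show "\<forall>\<^sub>F n in sequentially. dist (y n) x \<le> dist (inverse (real (Suc n))) 0"
      using y(2) by (simp add: dist_commute inverse_eq_divide less_imp_le)
  qed
  \<comment> \<open>Unit directions of the offsets, which are nonzero because one end lies on
    \<open>M\<close> and the other does not. They stay in the compact unit sphere of
    \<open>N\<close>; a subsequential limit \<open>n0\<close> is the direction of the tilt.\<close>
  define \<nu> where "\<nu> n = sgn (xs (\<kappa> n) - y n)" for n
  have ne: "xs (\<kappa> n) - y n \<noteq> 0" for n using \<kappa>(2) y(1) by (metis eq_iff_diff_eq_0)
  have \<nu>: "\<nu> n \<in> sphere 0 1 \<inter> N" for n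
    using ne y(3) N(1) by (auto simp: \<nu>_def norm_sgn sgn_div_norm intro: subspace_scale)
  have "compact (sphere 0 1 \<inter> N)" by (intro compact_Int_closed compact_sphere closed_subspace N(1))
  then obtain n0 r where n0: "n0 \<in> sphere 0 1 \<inter> N" and r: "strict_mono r" "(\<nu> \<circ> r) \<longlonglongrightarrow> n0"
    using \<nu> unfolding compact_def by blast
  have rlim: "filterlim r at_top sequentially" using r(1) by (rule filterlim_subseq)

  obtain e where e: "e > 0" "cball u e \<inter> affine hull (frechet_subdiff \<psi> x) \<subseteq> frechet_subdiff \<psi> x"
    using ri unfolding mem_rel_interior_cball by blast
  \<comment> \<open>At most \<open>e\<close>, so the tilted point stays in the ball provided by the
    relative interior; below \<epsilon>, so subgradients within \<open>\<epsilon> - \<delta>\<close>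
    of the tilted point are still in the prox-regularity radius around \<open>u\<close>.\<close>
  define \<delta> where "\<delta> = min e (\<epsilon> / 2)"
  have \<delta>: "0 < \<delta>" "\<delta> \<le> e" "\<delta> < \<epsilon>" "0 < \<epsilon> - \<delta>" using e \<epsilon> by (auto simp: \<delta>_def)
  have uS: "u \<in> frechet_subdiff \<psi> x" using ri rel_interior_subset by blast
  have "u + \<delta> *\<^sub>R n0 \<in> affine hull (frechet_subdiff \<psi> x)"
  proof -
    obtain n where n: "u = a + n" "n \<in> normal_space M x" using hull_inc[OF uS, of affine] aff by auto
    have "n + \<delta> *\<^sub>R n0 \<in> normal_space M x"
      using n n0 N(2) subspace_orthogonal_comp[of "tangent_space M x"] unfolding normal_space_def
      by (intro subspace_add subspace_scale) auto
    then show ?thesis unfolding aff n(1) by (simp add: add.assoc)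
  qed
  moreover have "u + \<delta> *\<^sub>R n0 \<in> cball u e" using \<delta> n0 by (simp add: dist_norm)
  ultimately have "u + \<delta> *\<^sub>R n0 \<in> frechet_subdiff \<psi> x" using e by blast
  moreover have yr: "(\<lambda>n. y (r n)) \<longlonglongrightarrow> x" using filterlim_compose[OF ylim rlim] .
  ultimately obtain w where w: "\<forall>\<^sub>F n in sequentially. w n \<in> frechet_subdiff \<psi> (y (r n))"
    "w \<longlonglongrightarrow> u + \<delta> *\<^sub>R n0"
    using inner[unfolded inner_semicontinuous_rel_def, rule_format, of "u + \<delta> *\<^sub>R n0" "\<lambda>n. y (r n)"] y(1)
    by blast
  define X where "X n = xs (\<kappa> (r n))" for n
  define Y where "Y n = y (r n)" for n
  define u' where "u' n = us (\<kappa> (r n))" for n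
  have klim: "filterlim (\<lambda>n. \<kappa> (r n)) at_top sequentially" using filterlim_compose[OF \<kappa>lim rlim] .
  have X: "X \<longlonglongrightarrow> x" and u': "u' \<longlonglongrightarrow> u" and X\<psi>: "(\<lambda>n. \<psi> (X n)) \<longlonglongrightarrow> \<psi> x"
    using filterlim_compose[OF xs klim] filterlim_compose[OF us klim] filterlim_compose[OF vals klim]
    by (simp_all add: X_def[abs_def] u'_def[abs_def])
  have Y: "Y \<longlonglongrightarrow> x" using yr by (simp add: Y_def[abs_def])
  have YU: "\<forall>\<^sub>F n in sequentially. Y n \<in> U" using topological_tendstoD[OF Y U] .
  \<comment> \<open>On \<open>M\<close> near \<open>x\<close> the function \<psi> equals the
    continuous \<open>h\<close>; this yields the closeness of values at \<open>Y n\<close> that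
    prox-regularity requires.\<close>
  have "(\<lambda>n. h (Y n)) \<longlonglongrightarrow> h x"
    using C2_on_continuous_on[OF h(1)] U Y
    by (metis continuous_on_eq_continuous_at isCont_tendsto_compose)
  then have "(\<lambda>n. ereal (h (Y n))) \<longlonglongrightarrow> \<psi> x" using h(2) xM U by simp
  then have Y\<psi>: "(\<lambda>n. \<psi> (Y n)) \<longlonglongrightarrow> \<psi> x"
    by (rule Lim_transform_eventually) (use YU h(2) y(1) in \<open>auto simp: Y_def elim: eventually_mono\<close>)
  have close: "\<forall>\<^sub>F n in sequentially. \<bar>\<psi> (Z n) - \<psi> x\<bar> < ereal \<epsilon>" if "(\<lambda>n. \<psi> (Z n)) \<longlonglongrightarrow> \<psi> x" for Z
  proof -
    obtain p where p: "\<psi> x = ereal p" using fin by auto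
    have "\<forall>\<^sub>F n in sequentially. \<psi> (Z n) \<in> {ereal (p - \<epsilon>)<..<ereal (p + \<epsilon>)}"
      using that \<epsilon> p by (intro topological_tendstoD) auto
    then show ?thesis
    proof eventually_elim
      case (elim n)
      then show ?case unfolding p by (cases "\<psi> (Z n)") auto
    qed
  qed
  \<comment> \<open>The two prox-regularity inequalities, based at \<open>Y n\<close> and at
    \<open>X n\<close>, are added; the values of \<psi> cancel and division by
    \<open>norm (X n - Y n)\<close> leaves the unit direction. In the limit the left side is
    \<delta> and the right side is 0.\<close>
  have "\<forall>\<^sub>F n in sequentially. (w n - u' n) \<bullet> \<nu> (r n) \<le> \<rho> * norm (X n - Y n)"
    using w(1) close[OF X\<psi>] close[OF Y\<psi>] tendstoD[OF X \<epsilon>] tendstoD[OF Y \<epsilon>] tendstoD[OF u' \<epsilon>]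
      tendstoD[OF w(2) \<delta>(4)]
  proof eventually_elim
    case (elim n)
    have "dist (w n) u < \<epsilon>"
      using elim(7) dist_triangle[of "w n" u "u + \<delta> *\<^sub>R n0"] n0 \<delta> by (simp add: dist_norm)
    then have 1: "\<psi> (X n) \<ge> \<psi> (Y n) + ereal (w n \<bullet> (X n - Y n)) - ereal (\<rho> / 2 * (norm (X n - Y n))\<^sup>2)"
      using elim(1)[folded Y_def] elim(3-5) by (intro prox[rule_format] conjI)
    from elim(2,4-6) have 2: "\<psi> (Y n) \<ge> \<psi> (X n) + ereal (u' n \<bullet> (Y n - X n)) - ereal (\<rho> / 2 * (norm (Y n - X n))\<^sup>2)"
      using sub[of "\<kappa> (r n)"] by (intro prox[rule_format] conjI) (simp_all add: X_def u'_def)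
    obtain p where p: "\<psi> x = ereal p" using fin by auto
    obtain p1 p2 where "\<psi> (X n) = ereal p1" "\<psi> (Y n) = ereal p2"
      using elim p by (cases "\<psi> (X n)"; cases "\<psi> (Y n)") auto
    with 1 2 have "(w n - u' n) \<bullet> (X n - Y n) \<le> \<rho> * (norm (X n - Y n))\<^sup>2"
      by (simp add: inner_diff_left inner_diff_right norm_minus_commute)
    moreover have "X n - Y n = norm (X n - Y n) *\<^sub>R \<nu> (r n)" "norm (X n - Y n) > 0"
      using ne[of "r n"] by (simp_all add: X_def Y_def \<nu>_def sgn_div_norm)
    ultimately have "norm (X n - Y n) * ((w n - u' n) \<bullet> \<nu> (r n)) \<le> norm (X n - Y n) * (\<rho> * norm (X n - Y n))"
      by (metis inner_scaleR_right mult.left_commute power2_eq_square)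
    then show ?case using \<open>norm (X n - Y n) > 0\<close> by simp
  qed
  moreover have "(\<lambda>n. (w n - u' n) \<bullet> \<nu> (r n)) \<longlonglongrightarrow> (u + \<delta> *\<^sub>R n0 - u) \<bullet> n0"
    using r(2) by (intro tendsto_intros w u') (simp add: o_def)
  moreover have "(\<lambda>n. \<rho> * norm (X n - Y n)) \<longlonglongrightarrow> \<rho> * norm (x - x)"
    by (intro tendsto_intros X Y)
  ultimately have "(u + \<delta> *\<^sub>R n0 - u) \<bullet> n0 \<le> \<rho> * norm (x - x)"
    using tendsto_le[OF sequentially_bot] by blast
  then show False using n0 \<delta> by (simp add: norm_eq_1)
qed

subsection \<open>Convergence of martingale transforms\<close>

lemma abs_inner_le_sum_squares:
  fixes u v :: "'a::real_inner"
  shows "\<bar>v \<bullet> u\<bar> \<le> (norm v)\<^sup>2 + (norm u)\<^sup>2"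
  using Cauchy_Schwarz_ineq2[of v u] sum_squares_bound[of "norm v" "norm u"] by (simp add: power2_eq_square)

context prob_space
begin

text \<open>Orthogonality of \<open>\<delta> k\<close> to the square-integrable \<open>F k\<close>-measurable functions encodes the
  martingale difference property without conditional expectations. The multipliers \<open>i\<close> are
  predictable; they are needed to stop the sums.\<close>

lemma predictable_transform_second_moment:
  fixes \<delta> :: "nat \<Rightarrow> 'a \<Rightarrow> 'b::euclidean_space" and i :: "nat \<Rightarrow> 'a \<Rightarrow> real"
  assumes sp: "\<And>k. space (F k) = space M"
    and mono: "\<And>j k. j \<le> k \<Longrightarrow> sets (F j) \<subseteq> sets (F k)"
    and sub: "\<And>k. sets (F k) \<subseteq> sets M"
    and adapted: "\<And>k. \<delta> k \<in> borel_measurable (F (Suc k))"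
    and int: "\<And>k. integrable M (\<lambda>\<omega>. (norm (\<delta> k \<omega>))\<^sup>2)"
    and bound: "\<And>k. expectation (\<lambda>\<omega>. (norm (\<delta> k \<omega>))\<^sup>2) \<le> K"
    and orth: "\<And>k Y. Y \<in> borel_measurable (F k) \<Longrightarrow> integrable M (\<lambda>\<omega>. (norm (Y \<omega>))\<^sup>2) \<Longrightarrow>
        expectation (\<lambda>\<omega>. Y \<omega> \<bullet> \<delta> k \<omega>) = 0"
    and i: "\<And>k. i k \<in> borel_measurable (F k)" "\<And>k \<omega>. \<bar>i k \<omega>\<bar> \<le> \<bar>a k\<bar>"
  defines "S \<equiv> \<lambda>n \<omega>. \<Sum>k<n. i k \<omega> *\<^sub>R \<delta> k \<omega>"
  shows "S n \<in> borel_measurable (F n) \<and> integrable M (\<lambda>\<omega>. (norm (S n \<omega>))\<^sup>2) \<and>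
    expectation (\<lambda>\<omega>. (norm (S n \<omega>))\<^sup>2) \<le> K * (\<Sum>k<n. (a k)\<^sup>2)"
proof (induction n)
  case 0
  then show ?case by (simp add: S_def)
next
  case (Suc n)
  have FM: "borel_measurable (F k) \<subseteq> borel_measurable M" for k
    by (intro measurable_mono) (use sp sub in auto)
  have Fmono: "borel_measurable (F j) \<subseteq> borel_measurable (F k)" if "j \<le> k" for j k
    by (intro measurable_mono) (use sp mono that in auto)
  have [measurable]: "\<delta> k \<in> borel_measurable M" "i k \<in> borel_measurable M" for k
    using adapted i(1) FM by blast+
  have SM[measurable]: "S n \<in> borel_measurable M" using Suc FM by blast
  define X where "X = (\<lambda>\<omega>. i n \<omega> *\<^sub>R \<delta> n \<omega>)"
  define Y where "Y = (\<lambda>\<omega>. i n \<omega> *\<^sub>R S n \<omega>)"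
  have [measurable]: "X \<in> borel_measurable M" "Y \<in> borel_measurable M" by (simp_all add: X_def Y_def)
  have i2: "(i n \<omega>)\<^sup>2 \<le> (a n)\<^sup>2" for \<omega> using i(2) by (simp add: abs_le_square_iff)
  have Xle: "(norm (X \<omega>))\<^sup>2 \<le> (a n)\<^sup>2 * (norm (\<delta> n \<omega>))\<^sup>2" for \<omega>
    using i2 by (simp add: X_def power_mult_distrib mult_right_mono)
  have Yle: "(norm (Y \<omega>))\<^sup>2 \<le> (a n)\<^sup>2 * (norm (S n \<omega>))\<^sup>2" for \<omega>
    using i2 by (simp add: Y_def power_mult_distrib mult_right_mono)
  have intX: "integrable M (\<lambda>\<omega>. (norm (X \<omega>))\<^sup>2)"
    by (rule Bochner_Integration.integrable_bound[OF integrable_mult_right[OF int, of "(a n)\<^sup>2"]])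
      (use Xle in auto)
  have intY: "integrable M (\<lambda>\<omega>. (norm (Y \<omega>))\<^sup>2)"
    by (rule Bochner_Integration.integrable_bound[OF integrable_mult_right[where f = "\<lambda>\<omega>. (norm (S n \<omega>))\<^sup>2" and c = "(a n)\<^sup>2"]])
      (use Yle Suc in auto)
  \<comment> \<open>The multiplier moves from the increment to the past sum, so the cross term pairs
    \<open>\<delta> n\<close> with an \<open>F n\<close>-measurable function and integrates to
    zero.\<close>
  have SX: "S n \<omega> \<bullet> X \<omega> = Y \<omega> \<bullet> \<delta> n \<omega>" for \<omega> by (simp add: X_def Y_def)
  have intYd: "integrable M (\<lambda>\<omega>. Y \<omega> \<bullet> \<delta> n \<omega>)"
    by (rule Bochner_Integration.integrable_bound[OF Bochner_Integration.integrable_add[OF intY int]])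
      (use abs_inner_le_sum_squares in auto)
  have Yn: "Y \<in> borel_measurable (F n)" using i(1) Suc by (simp add: Y_def borel_measurable_scaleR)
  have eq: "(norm (S (Suc n) \<omega>))\<^sup>2 = (norm (S n \<omega>))\<^sup>2 + 2 * (Y \<omega> \<bullet> \<delta> n \<omega>) + (norm (X \<omega>))\<^sup>2" for \<omega>
    unfolding SX[symmetric] S_def sum.lessThan_Suc X_def by (simp add: power2_norm_eq_inner algebra_simps inner_commute power2_eq_square[of "i n \<omega>"])
  have "S (Suc n) \<in> borel_measurable (F (Suc n))"
  proof -
    have "S n \<in> borel_measurable (F (Suc n))" "i n \<in> borel_measurable (F (Suc n))"
      using Suc i(1) Fmono[of n "Suc n"] by auto
    then show ?thesis using adapted[of n] by (simp add: S_def)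
  qed
  moreover have "expectation (\<lambda>\<omega>. (norm (S (Suc n) \<omega>))\<^sup>2)
      = expectation (\<lambda>\<omega>. (norm (S n \<omega>))\<^sup>2) + expectation (\<lambda>\<omega>. (norm (X \<omega>))\<^sup>2)"
    unfolding eq using Suc intYd intX orth[OF Yn intY] by simp
  moreover have "expectation (\<lambda>\<omega>. (norm (X \<omega>))\<^sup>2) \<le> (a n)\<^sup>2 * K"
  proof -
    have "expectation (\<lambda>\<omega>. (norm (X \<omega>))\<^sup>2) \<le> expectation (\<lambda>\<omega>. (a n)\<^sup>2 * (norm (\<delta> n \<omega>))\<^sup>2)"
      by (intro integral_mono intX integrable_mult_right int Xle)
    also have "\<dots> \<le> (a n)\<^sup>2 * K" using bound[of n] by (simp add: mult_left_mono)
    finally show ?thesis .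
  qed
  ultimately show ?case using Suc intYd intX by (simp add: eq algebra_simps)
qed

text \<open>Kolmogorov's maximal inequality by stopping: the partial sum stopped on leaving a ball
  has second moment controlled by the tail of the squares of \<open>a\<close>, and these tails tend
  to zero. Hence almost every path of partial sums is Cauchy.\<close>

lemma martingale_transform_L2_convergent:
  fixes \<delta> :: "nat \<Rightarrow> 'a \<Rightarrow> 'b::euclidean_space"
  assumes sp: "\<And>k. space (F k) = space M"
    and mono: "\<And>j k. j \<le> k \<Longrightarrow> sets (F j) \<subseteq> sets (F k)"
    and sub: "\<And>k. sets (F k) \<subseteq> sets M"
    and adapted: "\<And>k. \<delta> k \<in> borel_measurable (F (Suc k))"
    and int: "\<And>k. integrable M (\<lambda>\<omega>. (norm (\<delta> k \<omega>))\<^sup>2)"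
    and bound: "\<And>k. expectation (\<lambda>\<omega>. (norm (\<delta> k \<omega>))\<^sup>2) \<le> K"
    and orth: "\<And>k Y. Y \<in> borel_measurable (F k) \<Longrightarrow> integrable M (\<lambda>\<omega>. (norm (Y \<omega>))\<^sup>2) \<Longrightarrow>
        expectation (\<lambda>\<omega>. Y \<omega> \<bullet> \<delta> k \<omega>) = 0"
    and a: "summable (\<lambda>k. (a k)\<^sup>2)"
  shows "AE \<omega> in M. convergent (\<lambda>n. \<Sum>k<n. a k *\<^sub>R \<delta> k \<omega>)"
proof -
  define X where "X n \<omega> = (\<Sum>k<n. a k *\<^sub>R \<delta> k \<omega>)" for n \<omega>
  have FM: "borel_measurable (F k) \<subseteq> borel_measurable M" for k
    by (intro measurable_mono) (use sp sub in auto)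
  have Fmono: "borel_measurable (F j) \<subseteq> borel_measurable (F k)" if "j \<le> k" for j k
    by (intro measurable_mono) (use sp mono that in auto)
  have XF: "X n \<in> borel_measurable (F k)" if "n \<le> k" for n k
    unfolding X_def
  proof (intro borel_measurable_sum borel_measurable_scaleR borel_measurable_const)
    fix j assume "j \<in> {..<n}"
    then show "\<delta> j \<in> borel_measurable (F k)" using adapted[of j] Fmono[of "Suc j" k] that by auto
  qed
  have [measurable]: "X n \<in> borel_measurable M" for n using XF[of n n] FM by blast
  have "0 \<le> expectation (\<lambda>\<omega>. (norm (\<delta> 0 \<omega>))\<^sup>2)" by simp
  then have K: "0 \<le> K" using bound[of 0] by linarith
  have maximal: "prob {\<omega>\<in>space M. \<exists>n\<in>{m..m+p}. e \<le> norm (X n \<omega> - X m \<omega>)} \<le> K * (\<Sum>k. (a (k + m))\<^sup>2) / e\<^sup>2"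
    if e: "e > 0" for m p e
  proof -
    \<comment> \<open>Switches the sum off once it has left the ball of radius \<open>e\<close>
      around \<open>X m\<close>. \<open>X k\<close> involves only increments of index below
      \<open>k\<close>, so the switch is predictable.\<close>
    define i where "i k \<omega> = (if m \<le> k \<and> (\<forall>j\<in>{m..k}. norm (X j \<omega> - X m \<omega>) < e) then a k else 0)" for k \<omega>
    have im: "i k \<in> borel_measurable (F k)" for k
    proof -
      have [measurable]: "j \<in> {m..k} \<Longrightarrow> X j \<in> borel_measurable (F k)" for j
        using XF by simp
      show ?thesis
      proof (cases "m \<le> k")
        case True
        then have [measurable]: "X m \<in> borel_measurable (F k)" using XF by simp
        show ?thesis unfolding i_def by measurable
      qed (simp add: i_def[abs_def])
    qed
    \<comment> \<open>Vanishing below \<open>m\<close>, so that the second moment bound sees only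
      the block of weights starting at \<open>m\<close>.\<close>
    define b where "b k = (if m \<le> k then a k else 0)" for k
    define S where "S n \<omega> = (\<Sum>k<n. i k \<omega> *\<^sub>R \<delta> k \<omega>)" for n \<omega>
    have iab: "\<bar>i k \<omega>\<bar> \<le> \<bar>b k\<bar>" for k \<omega> by (simp add: i_def b_def)
    have S: "S n \<in> borel_measurable (F n)" "integrable M (\<lambda>\<omega>. (norm (S n \<omega>))\<^sup>2)"
      "expectation (\<lambda>\<omega>. (norm (S n \<omega>))\<^sup>2) \<le> K * (\<Sum>k<n. (b k)\<^sup>2)" for n
      using predictable_transform_second_moment[where F = F and i = i and a = b and K = K and n = n,
          OF sp mono sub adapted int bound orth im iab]
      by (simp_all add: S_def[abs_def])
    have [measurable]: "S n \<in> borel_measurable M" for n using S(1)[of n] FM by blast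
    \<comment> \<open>With \<open>q\<close> the first exit time, the stopped sum is frozen at
      \<open>X q - X m\<close>. An exit by time \<open>m + p\<close> is thus visible in the single
      random variable \<open>S (m + p)\<close>, to which Markov's inequality applies.\<close>
    have hit: "e \<le> norm (S (m + p) \<omega>)" if n: "n \<in> {m..m+p}" "e \<le> norm (X n \<omega> - X m \<omega>)" for n \<omega>
    proof -
      define q where "q = (LEAST n. n \<in> {m..m+p} \<and> e \<le> norm (X n \<omega> - X m \<omega>))"
      have q: "q \<in> {m..m+p}" "e \<le> norm (X q \<omega> - X m \<omega>)"
        using LeastI[of "\<lambda>n. n \<in> {m..m+p} \<and> e \<le> norm (X n \<omega> - X m \<omega>)" n] n by (auto simp: q_def)
      have lq: "norm (X j \<omega> - X m \<omega>) < e" if "j \<in> {m..<q}" for j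
      proof -
        have "\<not> (j \<in> {m..m+p} \<and> e \<le> norm (X j \<omega> - X m \<omega>))"
          by (rule not_less_Least) (use that in \<open>simp add: q_def\<close>)
        then show ?thesis using that q(1) by auto
      qed
      have "(m \<le> k \<and> (\<forall>j\<in>{m..k}. norm (X j \<omega> - X m \<omega>) < e)) \<longleftrightarrow> k \<in> {m..<q}" for k
      proof
        assume k: "m \<le> k \<and> (\<forall>j\<in>{m..k}. norm (X j \<omega> - X m \<omega>) < e)"
        then have "q \<notin> {m..k}" using q(2) by (metis not_le)
        then show "k \<in> {m..<q}" using k q(1) by auto
      qed (use lq in auto)
      then have "i k \<omega> = (if k \<in> {m..<q} then a k else 0)" for k
        by (simp add: i_def)
      then have "S (m + p) \<omega> = (\<Sum>k<m+p. if k \<in> {m..<q} then a k *\<^sub>R \<delta> k \<omega> else 0)"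
        unfolding S_def by (intro sum.cong) auto
      also have "\<dots> = (\<Sum>k\<in>{m..<q}. a k *\<^sub>R \<delta> k \<omega>)"
        using q by (subst sum.inter_restrict[symmetric]) (auto intro!: sum.cong)
      also have "\<dots> = X q \<omega> - X m \<omega>"
        using sum_diff_nat_ivl[of 0 m q "\<lambda>k. a k *\<^sub>R \<delta> k \<omega>"] q by (simp add: X_def lessThan_atLeast0)
      finally show ?thesis using q by simp
    qed
    have "prob {\<omega>\<in>space M. \<exists>n\<in>{m..m+p}. e \<le> norm (X n \<omega> - X m \<omega>)} \<le> prob {\<omega>\<in>space M. e\<^sup>2 \<le> (norm (S (m+p) \<omega>))\<^sup>2}"
      using hit e by (intro finite_measure_mono) (auto simp: power_mono)
    also have "\<dots> \<le> expectation (\<lambda>\<omega>. (norm (S (m+p) \<omega>))\<^sup>2) / e\<^sup>2"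
      by (rule integral_Markov_inequality_measure[where A = "{}"]) (use S e in auto)
    also have "\<dots> \<le> K * (\<Sum>k. (a (k + m))\<^sup>2) / e\<^sup>2"
    proof -
      have "(\<Sum>k<m+p. (b k)\<^sup>2) = (\<Sum>k<p. (a (k + m))\<^sup>2)"
      proof -
        have "(\<Sum>k<m+p. (b k)\<^sup>2) = (\<Sum>k\<in>{m..<m+p}. (a k)\<^sup>2)"
          by (intro sum.mono_neutral_cong_right) (auto simp: b_def)
        also have "\<dots> = (\<Sum>k<p. (a (k + m))\<^sup>2)"
          using sum.shift_bounds_nat_ivl[of "\<lambda>k. (a k)\<^sup>2" 0 m p] by (simp add: lessThan_atLeast0 add.commute)
        finally show ?thesis .
      qed
      also have "\<dots> \<le> (\<Sum>k. (a (k + m))\<^sup>2)"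
        using summable_ignore_initial_segment[OF a] by (intro sum_le_suminf) auto
      finally show ?thesis using S(3)[of "m+p"] K e
        by (intro divide_right_mono) (auto intro: order_trans mult_left_mono)
    qed
    finally show ?thesis .
  qed
  \<comment> \<open>The bound does not depend on the horizon \<open>p\<close>, so it passes to the
    union over all horizons.\<close>
  have maximal': "prob {\<omega>\<in>space M. \<exists>n\<ge>m. e \<le> norm (X n \<omega> - X m \<omega>)} \<le> K * (\<Sum>k. (a (k + m))\<^sup>2) / e\<^sup>2"
    if e: "e > 0" for m e
  proof -
    define A where "A p = {\<omega>\<in>space M. \<exists>n\<in>{m..m+p}. e \<le> norm (X n \<omega> - X m \<omega>)}" for p
    have "range A \<subseteq> sets M" unfolding A_def by auto
    moreover have "incseq A" unfolding A_def incseq_def by force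
    ultimately have "(\<lambda>p. prob (A p)) \<longlonglongrightarrow> prob (\<Union>p. A p)" by (rule finite_Lim_measure_incseq)
    moreover have "(\<Union>p. A p) = {\<omega>\<in>space M. \<exists>n\<ge>m. e \<le> norm (X n \<omega> - X m \<omega>)}"
      unfolding A_def using le_Suc_ex by fastforce
    ultimately show ?thesis using maximal[OF e, of m] by (intro LIMSEQ_le_const2) (auto simp: A_def)
  qed
  \<comment> \<open>The exceptional set lies in the exit event of every \<open>m\<close>, so its
    probability is below every tail bound.\<close>
  have "AE \<omega> in M. \<exists>m. \<forall>n\<ge>m. norm (X n \<omega> - X m \<omega>) < e" if e: "e > 0" for e
  proof (rule AE_I')
    let ?N = "{\<omega>\<in>space M. \<forall>m. \<exists>n\<ge>m. e \<le> norm (X n \<omega> - X m \<omega>)}"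
    have "(\<lambda>m. K * (\<Sum>k. (a (k + m))\<^sup>2) / e\<^sup>2) \<longlonglongrightarrow> K * 0 / e\<^sup>2"
      by (intro tendsto_intros suminf_exist_split2 a) (use e in auto)
    moreover have "prob ?N \<le> K * (\<Sum>k. (a (k + m))\<^sup>2) / e\<^sup>2" for m
      by (rule order_trans[OF finite_measure_mono maximal'[OF e, of m]]) auto
    ultimately have "prob ?N \<le> 0" by (intro LIMSEQ_le_const[where X = "\<lambda>m. K * (\<Sum>k. (a (k + m))\<^sup>2) / e\<^sup>2"]) auto
    then show "?N \<in> null_sets M" by (simp add: null_sets_def emeasure_eq_measure measure_le_0_iff)
  qed (auto simp: not_less)
  then have "AE \<omega> in M. \<forall>j::nat. \<exists>m. \<forall>n\<ge>m. norm (X n \<omega> - X m \<omega>) < 1 / Suc j"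
    by (simp add: AE_all_countable)
  then show ?thesis
  proof eventually_elim
    case (elim \<omega>)
    have "Cauchy (\<lambda>n. X n \<omega>)"
      unfolding Cauchy_altdef2
    proof (intro allI impI)
      fix e :: real assume "0 < e"
      then obtain j :: nat where "1 / Suc j < e" using nat_approx_posE by blast
      then show "\<exists>N. \<forall>n\<ge>N. dist (X n \<omega>) (X N \<omega>) < e" using elim[rule_format, of j]
        by (metis dist_norm less_trans)
    qed
    then show ?case by (simp add: X_def Cauchy_convergent)
  qed
qed

end

subsection \<open>Stochastic gradients at fresh samples\<close>

text \<open>Mean value inequality on the segment: there the gradient differs from \<open>G x\<close>
  by at most \<open>L * norm (y - x)\<close>. The constant \<open>L\<close> in place of the sharp
  \<open>L / 2\<close> is enough, as only differentiability is drawn from it.\<close>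

lemma lipschitz_gradient_linearization:
  fixes f :: "'a::euclidean_space \<Rightarrow> real"
  assumes f: "\<And>X. GDERIV f X :> G X" and L: "L-lipschitz_on UNIV G"
  shows "\<bar>f y - f x - (y - x) \<bullet> G x\<bar> \<le> L * (norm (y - x))\<^sup>2"
proof -
  have "norm (f y - f x - (y - x) \<bullet> G x) \<le> norm (y - x) * (L * norm (y - x))"
  proof (rule differentiable_bound_linearization[where S = "closed_segment x y" and f' = "\<lambda>z h. h \<bullet> G z"])
    show "x + t *\<^sub>R (y - x) \<in> closed_segment x y" if "t \<in> {0..1}" for t
      using that by (force simp: in_segment algebra_simps)
    show "(f has_derivative (\<lambda>h. h \<bullet> G z)) (at z within closed_segment x y)" for z
      using f[of z] by (auto simp: gderiv_def intro: has_derivative_at_withinI)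
    fix z assume z: "z \<in> closed_segment x y"
    show "onorm ((\<lambda>h. h \<bullet> G z) - (\<lambda>h. h \<bullet> G x)) \<le> L * norm (y - x)"
    proof (rule onorm_le)
      fix h
      have "\<bar>h \<bullet> (G z - G x)\<bar> \<le> norm h * norm (G z - G x)" by (rule Cauchy_Schwarz_ineq2)
      also have "\<dots> \<le> norm h * (L * norm (z - x))"
        using lipschitz_onD[OF L, of z x] by (intro mult_left_mono) (auto simp: dist_norm)
      also have "\<dots> \<le> norm h * (L * norm (y - x))"
        using segment_bound1[OF z] lipschitz_on_nonneg[OF L] by (intro mult_left_mono) auto
      finally show "norm (((\<lambda>h. h \<bullet> G z) - (\<lambda>h. h \<bullet> G x)) h) \<le> L * norm (y - x) * norm h"
        by (simp add: inner_diff_right algebra_simps)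
    qed
  qed auto
  then show ?thesis by (simp add: power2_eq_square algebra_simps)
qed

text \<open>The quadratic linearization error has the same constant for almost all samples, so it
  survives integration and differentiation passes under the integral.\<close>

lemma expected_loss_gderiv:
  fixes f :: "'w \<Rightarrow> 'a::euclidean_space \<Rightarrow> real"
  assumes D: "prob_space D" and f: "\<And>X. integrable D (\<lambda>\<zeta>. f \<zeta> X)"
    and G: "AE \<zeta> in D. \<forall>X. GDERIV (f \<zeta>) X :> G \<zeta> X"
    and L: "\<And>\<zeta>. L-lipschitz_on UNIV (G \<zeta>)"
    and int: "\<And>X. integrable D (\<lambda>\<zeta>. G \<zeta> X)"
  shows "GDERIV (expected_loss D f) X :> (\<integral>\<zeta>. G \<zeta> X \<partial>D)"
proof -
  interpret prob_space D by fact
  have bd: "norm (expected_loss D f Y - expected_loss D f X - (Y - X) \<bullet> (\<integral>\<zeta>. G \<zeta> X \<partial>D)) \<le> L * (norm (Y - X))\<^sup>2" for Y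
  proof -
    have i: "integrable D (\<lambda>\<zeta>. f \<zeta> Y - f \<zeta> X - (Y - X) \<bullet> G \<zeta> X)"
      by (intro Bochner_Integration.integrable_diff f integrable_inner_right int)
    have "expected_loss D f Y - expected_loss D f X - (Y - X) \<bullet> (\<integral>\<zeta>. G \<zeta> X \<partial>D)
        = (\<integral>\<zeta>. f \<zeta> Y - f \<zeta> X - (Y - X) \<bullet> G \<zeta> X \<partial>D)"
      by (simp add: expected_loss_def f int)
    also have "norm \<dots> \<le> (\<integral>\<zeta>. norm (f \<zeta> Y - f \<zeta> X - (Y - X) \<bullet> G \<zeta> X) \<partial>D)"
      by (rule integral_norm_bound)
    also have "\<dots> \<le> (\<integral>\<zeta>. L * (norm (Y - X))\<^sup>2 \<partial>D)"
    proof (rule integral_mono_AE)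
      show "AE \<zeta> in D. norm (f \<zeta> Y - f \<zeta> X - (Y - X) \<bullet> G \<zeta> X) \<le> L * (norm (Y - X))\<^sup>2"
        using G by eventually_elim (use lipschitz_gradient_linearization[OF _ L] in auto)
    qed (use i in auto)
    finally show ?thesis by (simp add: prob_space)
  qed
  show ?thesis unfolding gderiv_def
  proof (rule has_derivativeI)
    show "bounded_linear (\<lambda>h. h \<bullet> (\<integral>\<zeta>. G \<zeta> X \<partial>D))" by (rule bounded_linear_inner_left)
    show "((\<lambda>Y. (expected_loss D f Y - expected_loss D f X - (Y - X) \<bullet> (\<integral>\<zeta>. G \<zeta> X \<partial>D)) /\<^sub>R norm (Y - X)) \<longlongrightarrow> 0) (at X)"
    proof (rule Lim_null_comparison)
      show "\<forall>\<^sub>F Y in at X. norm ((expected_loss D f Y - expected_loss D f X - (Y - X) \<bullet> (\<integral>\<zeta>. G \<zeta> X \<partial>D)) /\<^sub>R norm (Y - X)) \<le> L * norm (Y - X)"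
        unfolding eventually_at_filter
      proof (intro always_eventually allI impI)
        fix Y assume "Y \<noteq> X"
        then have "norm (Y - X) > 0" by simp
        with bd[of Y] show "norm ((expected_loss D f Y - expected_loss D f X - (Y - X) \<bullet> (\<integral>\<zeta>. G \<zeta> X \<partial>D)) /\<^sub>R norm (Y - X)) \<le> L * norm (Y - X)"
          by (simp add: power2_eq_square pos_divide_le_eq divide_inverse_commute[symmetric] mult.assoc)
      qed
      have "((\<lambda>Y. L * norm (Y - X)) \<longlongrightarrow> L * norm (X - X)) (at X)" by (intro tendsto_intros)
      then show "((\<lambda>Y. L * norm (Y - X)) \<longlongrightarrow> 0) (at X)" by simp
    qed
  qed
qed

lemma gderiv_difference_quotient_LIMSEQ:
  fixes f :: "'a::euclidean_space \<Rightarrow> real"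
  assumes "GDERIV f x :> D"
  shows "(\<lambda>n. (f (x + inverse (real (Suc n)) *\<^sub>R e) - f x) / inverse (real (Suc n))) \<longlonglongrightarrow> e \<bullet> D"
proof -
  have "((\<lambda>s. x + s *\<^sub>R e) has_derivative (\<lambda>s. s *\<^sub>R e)) (at (0::real))"
    by (auto intro!: derivative_eq_intros)
  moreover have "(f has_derivative (\<lambda>h. h \<bullet> D)) (at (x + (0::real) *\<^sub>R e))"
    using assms by (simp add: gderiv_def)
  ultimately have "((\<lambda>s. f (x + s *\<^sub>R e)) has_derivative (\<lambda>s. (s *\<^sub>R e) \<bullet> D)) (at 0)"
    by (rule has_derivative_compose)
  then have "((\<lambda>s. f (x + s *\<^sub>R e)) has_real_derivative (e \<bullet> D)) (at 0)"
    by (simp add: has_field_derivative_def mult_commute_abs)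
  then have "((\<lambda>s. (f (x + s *\<^sub>R e) - f x) / s) \<longlongrightarrow> e \<bullet> D) (at 0)"
    by (simp add: DERIV_def)
  moreover have "filterlim (\<lambda>n. inverse (real (Suc n))) (at 0) sequentially"
    using LIMSEQ_inverse_real_of_nat by (auto simp: filterlim_at)
  ultimately show ?thesis by (rule filterlim_compose)
qed

text \<open>Each coordinate of the gradient is the limit of a sequence of difference quotients, and
  each quotient is measurable in the sample.\<close>

lemma gderiv_borel_measurable:
  fixes f :: "'w \<Rightarrow> 'a::euclidean_space \<Rightarrow> real"
  assumes f: "\<And>X. (\<lambda>\<zeta>. f \<zeta> X) \<in> borel_measurable D"
    and G: "\<And>\<zeta>. \<zeta> \<in> space D \<Longrightarrow> GDERIV (f \<zeta>) X :> G \<zeta>"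
  shows "G \<in> borel_measurable D"
  unfolding borel_measurable_euclidean_space[of G]
proof
  fix e :: 'a assume "e \<in> Basis"
  show "(\<lambda>\<zeta>. G \<zeta> \<bullet> e) \<in> borel_measurable D"
  proof (rule borel_measurable_LIMSEQ_metric)
    show "(\<lambda>\<zeta>. (f \<zeta> (X + inverse (real (Suc n)) *\<^sub>R e) - f \<zeta> X) / inverse (real (Suc n))) \<in> borel_measurable D" for n
      by (intro borel_measurable_divide borel_measurable_diff f borel_measurable_const)
    show "(\<lambda>n. (f \<zeta> (X + inverse (real (Suc n)) *\<^sub>R e) - f \<zeta> X) / inverse (real (Suc n))) \<longlonglongrightarrow> G \<zeta> \<bullet> e"
      if "\<zeta> \<in> space D" for \<zeta>
      using gderiv_difference_quotient_LIMSEQ[OF G[OF that], of e] by (simp only: inner_commute)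
  qed
qed

text \<open>The second argument is approximated by simple functions: with finitely many values, the
  composition is glued from measurable pieces, and continuity in that argument passes measurability
  to the limit.\<close>

lemma caratheodory_borel_measurable:
  fixes G :: "'w \<Rightarrow> 'a::{metric_space, second_countable_topology} \<Rightarrow> 'b::metric_space"
  assumes G: "\<And>X. (\<lambda>\<zeta>. G \<zeta> X) \<in> borel_measurable D" and cont: "\<And>\<zeta>. continuous_on UNIV (G \<zeta>)"
  shows "(\<lambda>(\<zeta>, X). G \<zeta> X) \<in> borel_measurable (D \<Otimes>\<^sub>M borel)"
proof -
  obtain s where s: "\<And>i. simple_function borel (s i)" "\<And>x::'a. (\<lambda>i. s i x) \<longlonglongrightarrow> x"
    using borel_measurable_implies_sequence_metric[of "\<lambda>x::'a. x" borel undefined]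
    by (simp add: measurable_ident_sets) blast
  show ?thesis
  proof (rule borel_measurable_LIMSEQ_metric[where f = "\<lambda>i (\<zeta>, X). G \<zeta> (s i X)"])
    fix i
    have "s i \<in> borel \<rightarrow>\<^sub>M count_space (range (s i))"
      using simple_functionD[OF s(1)[of i]] by (subst measurable_count_space_eq2) auto
    then have g: "(\<lambda>p. s i (snd p)) \<in> D \<Otimes>\<^sub>M borel \<rightarrow>\<^sub>M count_space (range (s i))"
      by (rule measurable_compose[OF measurable_snd])
    have f: "(\<lambda>p. G (fst p) X) \<in> borel_measurable (D \<Otimes>\<^sub>M borel)" for X
      by (rule measurable_compose[OF measurable_fst G])
    have "countable (range (s i))"
      using simple_functionD(1)[OF s(1)[of i]] by (simp add: countable_finite)
    from measurable_compose_countable'[where f = "\<lambda>X p. G (fst p) X", OF f g this]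
    show "(\<lambda>(\<zeta>, X). G \<zeta> (s i X)) \<in> borel_measurable (D \<Otimes>\<^sub>M borel)"
      by (simp add: case_prod_beta')
  next
    fix p
    show "(\<lambda>i. case p of (\<zeta>, X) \<Rightarrow> G \<zeta> (s i X)) \<longlonglongrightarrow> (case p of (\<zeta>, X) \<Rightarrow> G \<zeta> X)"
    proof (cases p)
      case (Pair \<zeta> X)
      have "isCont (G \<zeta>) X" using cont by (simp add: continuous_on_eq_continuous_at)
      from isCont_tendsto_compose[OF this s(2)] show ?thesis by (simp add: Pair)
    qed
  qed
qed

section \<open>Averaging over a sample that is independent of the past\<close>

context prob_space
begin

text \<open>Rectangles determine the product measure. With \<open>Y\<close> the identity into a
  sub-sigma-algebra, independence from the past becomes a product of laws.\<close>

lemma joint_distribution_eq_pairI: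
  assumes X[measurable]: "X \<in> M \<rightarrow>\<^sub>M S" and Y[measurable]: "Y \<in> M \<rightarrow>\<^sub>M T"
    and indep: "\<And>A B. A \<in> sets S \<Longrightarrow> B \<in> sets T \<Longrightarrow>
      prob (X -` A \<inter> Y -` B \<inter> space M) = prob (X -` A \<inter> space M) * prob (Y -` B \<inter> space M)"
  shows "distr M (S \<Otimes>\<^sub>M T) (\<lambda>\<omega>. (X \<omega>, Y \<omega>)) = distr M S X \<Otimes>\<^sub>M distr M T Y"
proof -
  interpret X: prob_space "distr M S X" by (rule prob_space_distr) simp
  interpret Y: prob_space "distr M T Y" by (rule prob_space_distr) simp
  have "distr M S X \<Otimes>\<^sub>M distr M T Y = distr M (S \<Otimes>\<^sub>M T) (\<lambda>\<omega>. (X \<omega>, Y \<omega>))"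
  proof (rule pair_measure_eqI)
    fix A B assume A: "A \<in> sets (distr M S X)" and B: "B \<in> sets (distr M T Y)"
    have "(\<lambda>\<omega>. (X \<omega>, Y \<omega>)) -` (A \<times> B) \<inter> space M = X -` A \<inter> Y -` B \<inter> space M" by auto
    then show "emeasure (distr M S X) A * emeasure (distr M T Y) B
        = emeasure (distr M (S \<Otimes>\<^sub>M T) (\<lambda>\<omega>. (X \<omega>, Y \<omega>))) (A \<times> B)"
      using A B indep[of A B] by (simp add: emeasure_distr emeasure_eq_measure ennreal_mult'[symmetric])
  qed (unfold_locales, simp)
  then show ?thesis ..
qed

text \<open>Fubini in the role of conditioning: the inner integral averages over \<open>X\<close>
  while \<open>Y\<close> stays frozen.\<close>

lemma nn_integral_joint_iterated:
  assumes X[measurable]: "X \<in> M \<rightarrow>\<^sub>M S" and Y[measurable]: "Y \<in> M \<rightarrow>\<^sub>M T"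
    and joint: "distr M (S \<Otimes>\<^sub>M T) (\<lambda>\<omega>. (X \<omega>, Y \<omega>)) = distr M S X \<Otimes>\<^sub>M distr M T Y"
    and h: "h \<in> borel_measurable (S \<Otimes>\<^sub>M T)"
  shows "(\<integral>\<^sup>+\<omega>. h (X \<omega>, Y \<omega>) \<partial>M) = (\<integral>\<^sup>+\<omega>. (\<integral>\<^sup>+x. h (x, Y \<omega>) \<partial>distr M S X) \<partial>M)"
proof -
  interpret X: prob_space "distr M S X" by (rule prob_space_distr) simp
  interpret Y: prob_space "distr M T Y" by (rule prob_space_distr) simp
  interpret XY: pair_sigma_finite "distr M S X" "distr M T Y" ..
  note [measurable] = h
  have "(\<integral>\<^sup>+\<omega>. h (X \<omega>, Y \<omega>) \<partial>M) = (\<integral>\<^sup>+p. h p \<partial>(distr M S X \<Otimes>\<^sub>M distr M T Y))"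
    unfolding joint[symmetric] by (subst nn_integral_distr) auto
  also have "\<dots> = (\<integral>\<^sup>+y. \<integral>\<^sup>+x. h (x, y) \<partial>distr M S X \<partial>distr M T Y)"
    using XY.nn_integral_snd[of h] by simp
  also have "\<dots> = (\<integral>\<^sup>+\<omega>. (\<integral>\<^sup>+x. h (x, Y \<omega>) \<partial>distr M S X) \<partial>M)"
    by (subst nn_integral_distr) (auto intro!: X.borel_measurable_nn_integral)
  finally show ?thesis .
qed

lemma integral_joint_iterated:
  fixes h :: "_ \<Rightarrow> real"
  assumes X[measurable]: "X \<in> M \<rightarrow>\<^sub>M S" and Y[measurable]: "Y \<in> M \<rightarrow>\<^sub>M T"
    and joint: "distr M (S \<Otimes>\<^sub>M T) (\<lambda>\<omega>. (X \<omega>, Y \<omega>)) = distr M S X \<Otimes>\<^sub>M distr M T Y"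
    and h: "h \<in> borel_measurable (S \<Otimes>\<^sub>M T)"
    and int: "integrable M (\<lambda>\<omega>. h (X \<omega>, Y \<omega>))"
  shows "expectation (\<lambda>\<omega>. h (X \<omega>, Y \<omega>)) = expectation (\<lambda>\<omega>. \<integral>x. h (x, Y \<omega>) \<partial>distr M S X)"
proof -
  interpret X: prob_space "distr M S X" by (rule prob_space_distr) simp
  interpret Y: prob_space "distr M T Y" by (rule prob_space_distr) simp
  interpret XY: pair_sigma_finite "distr M S X" "distr M T Y" ..
  note [measurable] = h
  have i: "integrable (distr M S X \<Otimes>\<^sub>M distr M T Y) h"
    unfolding joint[symmetric] using int by (subst integrable_distr_eq) auto
  have "expectation (\<lambda>\<omega>. h (X \<omega>, Y \<omega>)) = (\<integral>p. h p \<partial>(distr M S X \<Otimes>\<^sub>M distr M T Y))"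
    unfolding joint[symmetric] by (subst integral_distr) auto
  also have "\<dots> = (\<integral>y. \<integral>x. h (x, y) \<partial>distr M S X \<partial>distr M T Y)"
    using XY.integral_snd[of "\<lambda>x y. h (x, y)"] i by simp
  also have "\<dots> = expectation (\<lambda>\<omega>. \<integral>x. h (x, Y \<omega>) \<partial>distr M S X)"
    by (subst integral_distr) (auto intro!: X.borel_measurable_lebesgue_integral)
  finally show ?thesis .
qed

text \<open>With the past frozen, \<open>G\<close> minus its mean \<open>g\<close> integrates to
  zero over the fresh sample, which gives orthogonality to everything \<open>F\<close>-measurable;
  its second moment is a variance and so is below that of \<open>G\<close>.\<close>

lemma fresh_sample_noise:
  fixes G :: "'w \<Rightarrow> 'b::euclidean_space \<Rightarrow> 'c::euclidean_space"
  assumes sp: "space F = space M" and sub: "sets F \<subseteq> sets M"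
    and \<xi>[measurable]: "\<xi> \<in> M \<rightarrow>\<^sub>M D" and distr: "distr M D \<xi> = D"
    and indep: "\<forall>A\<in>sets D. \<forall>B\<in>sets F.
        prob (\<xi> -` A \<inter> space M \<inter> B) = prob (\<xi> -` A \<inter> space M) * prob B"
    and w: "w \<in> borel_measurable F"
    and G: "(\<lambda>(\<zeta>, X). G \<zeta> X) \<in> borel_measurable (D \<Otimes>\<^sub>M borel)"
    and g: "\<And>X. integrable D (\<lambda>\<zeta>. G \<zeta> X)" "g \<in> borel_measurable borel" "\<And>X. g X = (\<integral>\<zeta>. G \<zeta> X \<partial>D)"
    and C: "C \<ge> 0" "AE \<omega> in M. (\<integral>\<^sup>+ \<zeta>. ennreal ((norm (G \<zeta> (w \<omega>)))\<^sup>2) \<partial>D) \<le> ennreal C"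
  defines "\<delta> \<equiv> \<lambda>\<omega>. G (\<xi> \<omega>) (w \<omega>) - g (w \<omega>)"
  shows "integrable M (\<lambda>\<omega>. (norm (\<delta> \<omega>))\<^sup>2)"
    and "expectation (\<lambda>\<omega>. (norm (\<delta> \<omega>))\<^sup>2) \<le> C"
    and "\<And>Y. Y \<in> borel_measurable F \<Longrightarrow> integrable M (\<lambda>\<omega>. (norm (Y \<omega>))\<^sup>2) \<Longrightarrow>
        expectation (\<lambda>\<omega>. Y \<omega> \<bullet> \<delta> \<omega>) = 0"
proof -
  interpret D: prob_space D using prob_space_distr[OF \<xi>] distr by simp
  have FM: "borel_measurable F \<subseteq> borel_measurable M"
    by (intro measurable_mono) (use sp sub in auto)
  have [measurable]: "w \<in> borel_measurable F" "w \<in> borel_measurable M" using w FM by auto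
  \<comment> \<open>The outcome itself, seen through \<open>F\<close>, serves as the random variable
    that carries the whole past; \<open>w\<close> and \<open>Y\<close> are functions of it.\<close>
  have id: "(\<lambda>\<omega>. \<omega>) \<in> M \<rightarrow>\<^sub>M F" using sp sub by (auto simp: measurable_def sets.Int_space_eq2)
  have joint: "distr M (D \<Otimes>\<^sub>M F) (\<lambda>\<omega>. (\<xi> \<omega>, \<omega>)) = distr M D \<xi> \<Otimes>\<^sub>M distr M F (\<lambda>\<omega>. \<omega>)"
  proof (rule joint_distribution_eq_pairI[OF \<xi> id])
    fix A B assume AB: "A \<in> sets D" "B \<in> sets F"
    then have "B \<subseteq> space M" using sets.sets_into_space sp by metis
    then show "prob (\<xi> -` A \<inter> (\<lambda>\<omega>. \<omega>) -` B \<inter> space M)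
        = prob (\<xi> -` A \<inter> space M) * prob ((\<lambda>\<omega>. \<omega>) -` B \<inter> space M)"
      using indep[rule_format, OF AB] by (simp add: Int_absorb1 Int_absorb2 inf_assoc inf_commute[of B])
  qed
  note [measurable] = g(2)
  have G1[measurable]: "(\<lambda>p. G (fst p) (snd p)) \<in> borel_measurable (D \<Otimes>\<^sub>M borel)"
    using G by (simp add: case_prod_beta')
  have Gm: "(\<lambda>p. G (fst p) (w (snd p))) \<in> borel_measurable (D \<Otimes>\<^sub>M F)"
    using measurable_compose[OF _ G1, of "\<lambda>p. (fst p, w (snd p))" "D \<Otimes>\<^sub>M F"] by simp
  have Gm': "(\<lambda>\<omega>. G (\<xi> \<omega>) (w \<omega>)) \<in> borel_measurable M"
    using measurable_compose[OF _ G1, of "\<lambda>\<omega>. (\<xi> \<omega>, w \<omega>)" M] by simp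
  have \<delta>m[measurable]: "\<delta> \<in> borel_measurable M"
    unfolding \<delta>_def using Gm' by simp
  \<comment> \<open>The variance is the second moment minus \<open>(norm (g X))\<^sup>2\<close>, so
    \<open>C\<close> is inherited without a loss in the constant.\<close>
  have var: "(\<integral>\<^sup>+ \<zeta>. ennreal ((norm (G \<zeta> X - g X))\<^sup>2) \<partial>D) \<le> ennreal C"
    if X: "(\<integral>\<^sup>+ \<zeta>. ennreal ((norm (G \<zeta> X))\<^sup>2) \<partial>D) \<le> ennreal C" for X
  proof -
    have [measurable]: "(\<lambda>\<zeta>. G \<zeta> X) \<in> borel_measurable D" using g(1) by (rule borel_measurable_integrable)
    have i: "integrable D (\<lambda>\<zeta>. (norm (G \<zeta> X))\<^sup>2)"
      using X by (intro integrableI_bounded) (auto intro: le_less_trans)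
    have "ennreal (\<integral>\<zeta>. (norm (G \<zeta> X))\<^sup>2 \<partial>D) \<le> ennreal C"
      using X nn_integral_eq_integral[OF i] by simp
    then have le: "(\<integral>\<zeta>. (norm (G \<zeta> X))\<^sup>2 \<partial>D) \<le> C" using C by simp
    have eq: "(norm (G \<zeta> X - g X))\<^sup>2 = (norm (G \<zeta> X))\<^sup>2 - 2 * (G \<zeta> X \<bullet> g X) + (norm (g X))\<^sup>2" for \<zeta>
      by (simp add: power2_norm_eq_inner algebra_simps inner_commute)
    have i2: "integrable D (\<lambda>\<zeta>. (norm (G \<zeta> X - g X))\<^sup>2)"
      unfolding eq using i g(1) by simp
    have "(\<integral>\<zeta>. (norm (G \<zeta> X - g X))\<^sup>2 \<partial>D) = (\<integral>\<zeta>. (norm (G \<zeta> X))\<^sup>2 \<partial>D) - (norm (g X))\<^sup>2"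
      unfolding eq using i g(1) by (simp add: g(3)[symmetric] D.prob_space power2_norm_eq_inner)
    then have "(\<integral>\<zeta>. (norm (G \<zeta> X - g X))\<^sup>2 \<partial>D) \<le> C" using le by (smt (verit) zero_le_power2)
    then show ?thesis using nn_integral_eq_integral[OF i2] by (simp add: ennreal_leI)
  qed
  have nn: "(\<integral>\<^sup>+\<omega>. ennreal ((norm (\<delta> \<omega>))\<^sup>2) \<partial>M) \<le> ennreal C"
  proof -
    have "(\<integral>\<^sup>+\<omega>. ennreal ((norm (\<delta> \<omega>))\<^sup>2) \<partial>M)
        = (\<integral>\<^sup>+\<omega>. \<integral>\<^sup>+\<zeta>. ennreal ((norm (G \<zeta> (w \<omega>) - g (w \<omega>)))\<^sup>2) \<partial>D \<partial>M)"
      using nn_integral_joint_iterated[OF \<xi> id joint, of "\<lambda>p. ennreal ((norm (G (fst p) (w (snd p)) - g (w (snd p))))\<^sup>2)"]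
        Gm by (simp add: distr \<delta>_def)
    also have "\<dots> \<le> (\<integral>\<^sup>+\<omega>. ennreal C \<partial>M)"
      by (rule nn_integral_mono_AE) (use C(2) in eventually_elim, rule var)
    also have "\<dots> = ennreal C" by (simp add: emeasure_space_1)
    finally show ?thesis .
  qed
  show int: "integrable M (\<lambda>\<omega>. (norm (\<delta> \<omega>))\<^sup>2)"
    using nn by (intro integrableI_bounded) (auto intro: le_less_trans)
  show "expectation (\<lambda>\<omega>. (norm (\<delta> \<omega>))\<^sup>2) \<le> C"
    using nn nn_integral_eq_integral[OF int] C by simp
  fix Y :: "'a \<Rightarrow> 'c" assume Y[measurable]: "Y \<in> borel_measurable F" and iY: "integrable M (\<lambda>\<omega>. (norm (Y \<omega>))\<^sup>2)"
  have [measurable]: "Y \<in> borel_measurable M" using Y FM by blast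
  have iYd: "integrable M (\<lambda>\<omega>. Y \<omega> \<bullet> \<delta> \<omega>)"
    by (rule Bochner_Integration.integrable_bound[OF Bochner_Integration.integrable_add[OF iY int]])
      (use abs_inner_le_sum_squares in auto)
  have "expectation (\<lambda>\<omega>. Y \<omega> \<bullet> \<delta> \<omega>) = expectation (\<lambda>\<omega>. \<integral>\<zeta>. Y \<omega> \<bullet> (G \<zeta> (w \<omega>) - g (w \<omega>)) \<partial>D)"
    using integral_joint_iterated[OF \<xi> id joint, of "\<lambda>p. Y (snd p) \<bullet> (G (fst p) (w (snd p)) - g (w (snd p)))"]
      Gm iYd by (simp add: distr \<delta>_def)
  also have "\<dots> = 0" using g(1) by (simp add: D.prob_space g(3)[symmetric])
  finally show "expectation (\<lambda>\<omega>. Y \<omega> \<bullet> \<delta> \<omega>) = 0" .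
qed

end

subsection \<open>Sample paths of RMDA\<close>

lemma rmda_step_pos:
  assumes "\<forall>t\<ge>1. 0 < \<eta> t"
  shows "0 < rmda_beta (Suc t) * \<eta> (Suc t)"
  using assms by (intro mult_pos_pos) (simp_all add: rmda_beta_def)

lemma rmda_alpha_nonneg:
  assumes "\<forall>t\<ge>1. 0 < \<eta> t"
  shows "0 \<le> rmda_alpha \<eta> t"
proof (induction t)
  case (Suc t)
  then show ?case using rmda_step_pos[OF assms, of t] by simp
qed simp

lemma rmda_alpha_pos:
  assumes "\<forall>t\<ge>1. 0 < \<eta> t"
  shows "0 < rmda_alpha \<eta> (Suc t)"
  using rmda_alpha_nonneg[OF assms, of t] rmda_step_pos[OF assms, of t] by simp

text \<open>These facts make the ratios averaging weights:
  \<open>1 - rmda_ratio \<eta> (Suc t)\<close> is the factor that changes the normalization from one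
  step to the next. At \<open>t = 0\<close> the ratio is 1.\<close>

lemma rmda_ratio_Suc:
  assumes "\<forall>t\<ge>1. 0 < \<eta> t"
  shows "0 \<le> rmda_ratio \<eta> (Suc t)" and "rmda_ratio \<eta> (Suc t) \<le> 1"
    and "1 - rmda_ratio \<eta> (Suc t) = rmda_alpha \<eta> t * inverse (rmda_alpha \<eta> (Suc t))"
proof -
  have \<eta>: "0 \<le> rmda_beta (Suc t) * \<eta> (Suc t)" using rmda_step_pos[OF assms, of t] by simp
  have pos: "0 < rmda_alpha \<eta> (Suc t)" by (rule rmda_alpha_pos[OF assms])
  show "0 \<le> rmda_ratio \<eta> (Suc t)"
    unfolding rmda_ratio_def by (rule mult_nonneg_nonneg[OF \<eta>]) (use pos in simp)
  show eq: "1 - rmda_ratio \<eta> (Suc t) = rmda_alpha \<eta> t * inverse (rmda_alpha \<eta> (Suc t))"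
  proof -
    have "1 = rmda_alpha \<eta> (Suc t) * inverse (rmda_alpha \<eta> (Suc t))" using pos by simp
    also have "\<dots> = rmda_alpha \<eta> t * inverse (rmda_alpha \<eta> (Suc t)) + rmda_ratio \<eta> (Suc t)"
      by (subst (1) rmda_alpha.simps(2)) (simp only: rmda_ratio_def distrib_right)
    finally show ?thesis by simp
  qed
  have "0 \<le> rmda_alpha \<eta> t * inverse (rmda_alpha \<eta> (Suc t))"
    using rmda_alpha_nonneg[OF assms, of t] pos by (intro mult_nonneg_nonneg) auto
  then show "rmda_ratio \<eta> (Suc t) \<le> 1" using eq by linarith
qed

lemma rmda_path_Suc:
  assumes "rmda_path f \<psi> W0 \<eta> c s V Wt W"
  shows "V (Suc n) = V n + (rmda_beta (Suc n) * \<eta> (Suc n)) *\<^sub>R gradient (f (s (Suc n))) (W n)"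
    and "is_arg_min
          (\<lambda>X. ereal (V (Suc n) \<bullet> X + rmda_beta (Suc n) / 2 * (norm (X - W0))\<^sup>2)
                + ereal (rmda_alpha \<eta> (Suc n)) * \<psi> X)
          (\<lambda>X. True) (Wt (Suc n))"
    and "W (Suc n) = (1 - c (Suc n)) *\<^sub>R W n + c (Suc n) *\<^sub>R Wt (Suc n)"
proof -
  have "1 \<le> Suc n" by simp
  note step = assms[unfolded rmda_path_def, THEN conjunct2, THEN conjunct2, rule_format, OF this, unfolded diff_Suc_1]
  from step[THEN conjunct1] show "V (Suc n) = V n + (rmda_beta (Suc n) * \<eta> (Suc n)) *\<^sub>R gradient (f (s (Suc n))) (W n)" .
  from step[THEN conjunct2, THEN conjunct1] show "is_arg_min
          (\<lambda>X. ereal (V (Suc n) \<bullet> X + rmda_beta (Suc n) / 2 * (norm (X - W0))\<^sup>2)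
                + ereal (rmda_alpha \<eta> (Suc n)) * \<psi> X)
          (\<lambda>X. True) (Wt (Suc n))" .
  from step[THEN conjunct2, THEN conjunct2] show "W (Suc n) = (1 - c (Suc n)) *\<^sub>R W n + c (Suc n) *\<^sub>R Wt (Suc n)" .
qed

lemma rmda_iterates_tendsto:
  assumes path: "rmda_path f \<psi> W0 \<eta> c s V Wt W"
    and c: "\<forall>t\<ge>1. 0 \<le> c t \<and> c t \<le> 1" "filterlim (\<lambda>n. \<Sum>t=1..n. c t) at_top sequentially"
    and Wt: "Wt \<longlonglongrightarrow> x"
  shows "W \<longlonglongrightarrow> x"
proof (rule convex_average_tendsto[where r = "\<lambda>n. c (Suc n)" and u = "\<lambda>n. Wt (Suc n)"])
  show "W (Suc n) = (1 - c (Suc n)) *\<^sub>R W n + c (Suc n) *\<^sub>R Wt (Suc n)" for n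
    using rmda_path_Suc(3)[OF path] .
  show "filterlim (\<lambda>n. \<Sum>k<n. c (Suc k)) at_top sequentially"
    using c(2) by (simp add: sum.atLeast1_atMost_eq)
qed (use c(1) LIMSEQ_Suc[OF Wt] in auto)

lemma rmda_dual_average_tendsto:
  assumes path: "rmda_path f \<psi> W0 \<eta> c s V Wt W"
    and \<eta>: "\<forall>t\<ge>1. 0 < \<eta> t"
    and ratio: "filterlim (\<lambda>n. \<Sum>t=1..n. rmda_ratio \<eta> t) at_top sequentially"
    and noise: "convergent (\<lambda>n. \<Sum>k<n. rmda_ratio \<eta> (Suc k) *\<^sub>R
                  (gradient (f (s (Suc k))) (W k) - g (W k)))"
    and W: "W \<longlonglongrightarrow> x" and g: "isCont g x"
  shows "(\<lambda>t. V t /\<^sub>R rmda_alpha \<eta> t) \<longlonglongrightarrow> g x"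
proof -
  define r where "r k = rmda_ratio \<eta> (Suc k)" for k
  define \<delta> where "\<delta> k = gradient (f (s (Suc k))) (W k) - g (W k)" for k
  obtain l where l: "(\<lambda>n. \<Sum>k<n. r k *\<^sub>R \<delta> k) \<longlonglongrightarrow> l"
    using noise unfolding convergent_def r_def \<delta>_def by blast
  \<comment> \<open>The tail of the noise series, which tends to 0 and changes by exactly the
    negative of the noise in each step.\<close>
  define R where "R n = l - (\<Sum>k<n. r k *\<^sub>R \<delta> k)" for n
  have R: "R \<longlonglongrightarrow> 0"
    using tendsto_diff[OF tendsto_const l, of l] by (simp add: R_def[abs_def])
  define q where "q t = V t /\<^sub>R rmda_alpha \<eta> t" for t
  have q: "q (Suc n) = (1 - r n) *\<^sub>R q n + r n *\<^sub>R gradient (f (s (Suc n))) (W n)" for n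
  proof -
    \<comment> \<open>At \<open>n = 0\<close> the inverse of \<open>rmda_alpha\<close> is the
      default 0, and the identity holds because \<open>V 0 = 0\<close>.\<close>
    have V: "rmda_alpha \<eta> n *\<^sub>R q n = V n"
    proof (cases n)
      case 0
      then show ?thesis using path by (simp add: rmda_path_def)
    next
      case (Suc m)
      then show ?thesis using rmda_alpha_pos[OF \<eta>, of m] by (simp add: q_def)
    qed
    have "(1 - r n) *\<^sub>R q n = inverse (rmda_alpha \<eta> (Suc n)) *\<^sub>R (rmda_alpha \<eta> n *\<^sub>R q n)"
      unfolding r_def rmda_ratio_Suc(3)[OF \<eta>] by (simp only: scaleR_scaleR mult.commute)
    then show ?thesis
      unfolding V unfolding q_def rmda_path_Suc(1)[OF path] r_def rmda_ratio_def
      by (simp only: scaleR_add_right scaleR_scaleR mult_ac)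
  qed
  \<comment> \<open>Adding the tail of the noise series turns the noisy recursion into an exact averaging
    recursion with convergent inputs.\<close>
  have "(\<lambda>n. q n + R n) \<longlonglongrightarrow> g x"
  proof (rule convex_average_tendsto[where r = r and u = "\<lambda>n. g (W n) + R n"])
    fix n
    have "R (Suc n) = R n - r n *\<^sub>R \<delta> n" by (simp add: R_def)
    then show "q (Suc n) + R (Suc n) = (1 - r n) *\<^sub>R (q n + R n) + r n *\<^sub>R (g (W n) + R n)"
      unfolding q \<delta>_def by (simp add: algebra_simps)
    show "0 \<le> r n" "r n \<le> 1" using rmda_ratio_Suc[OF \<eta>] by (simp_all add: r_def)
  next
    show "filterlim (\<lambda>n. \<Sum>k<n. r k) at_top sequentially"
      using ratio by (simp add: sum.atLeast1_atMost_eq r_def)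
    show "(\<lambda>n. g (W n) + R n) \<longlonglongrightarrow> g x"
      using tendsto_add[OF isCont_tendsto_compose[OF g W] R] by simp
  qed
  from tendsto_diff[OF this R] show ?thesis by (simp add: q_def)
qed

text \<open>The deterministic half, for one sample path: optimality of the subproblems supplies
  subgradients at \<open>Wt t\<close>, and the limit of the dual average identifies their
  limit.\<close>

lemma rmda_path_identification:
  fixes \<psi> :: "'a::euclidean_space \<Rightarrow> ereal"
  assumes path: "rmda_path f \<psi> W0 \<eta> c s V Wt W"
    and nm: "\<forall>X. \<psi> X \<noteq> -\<infinity>" and \<eta>: "\<forall>t\<ge>1. 0 < \<eta> t"
    and dual: "(\<lambda>t. V t /\<^sub>R rmda_alpha \<eta> t) \<longlonglongrightarrow> v"
    and \<beta>: "(\<lambda>t. rmda_beta t * inverse (rmda_alpha \<eta> t)) \<longlonglongrightarrow> 0"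
    and Wt: "Wt \<longlonglongrightarrow> x"
    and pr: "prox_regular_at \<psi> x" and sc: "subdiff_continuous_at \<psi> x" and ps: "partly_smooth \<psi> M x"
    and ri: "- v \<in> rel_interior (frechet_subdiff \<psi> x)"
  shows "\<exists>T0. \<forall>t\<ge>T0. Wt t \<in> M"
proof -
  have vS: "- v \<in> frechet_subdiff \<psi> x" using ri rel_interior_subset by blast
  then have fin: "\<bar>\<psi> x\<bar> \<noteq> \<infinity>" by (simp add: frechet_subdiff_def)
  define u where "u t = - ((V t + rmda_beta t *\<^sub>R (Wt t - W0)) /\<^sub>R rmda_alpha \<eta> t)" for t
  have ueq: "u t = - (V t /\<^sub>R rmda_alpha \<eta> t + (rmda_beta t * inverse (rmda_alpha \<eta> t)) *\<^sub>R (Wt t - W0))" for t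
    by (simp only: u_def scaleR_add_right scaleR_scaleR mult.commute)
  have "(\<lambda>t. - (V t /\<^sub>R rmda_alpha \<eta> t + (rmda_beta t * inverse (rmda_alpha \<eta> t)) *\<^sub>R (Wt t - W0)))
      \<longlonglongrightarrow> - (v + 0 *\<^sub>R (x - W0))"
    by (intro tendsto_intros dual \<beta> Wt)
  then have u: "u \<longlonglongrightarrow> - v" unfolding ueq[symmetric] by simp
  have sub: "u (Suc n) \<in> frechet_subdiff \<psi> (Wt (Suc n))" for n
    unfolding u_def using nm fin
    by (intro regularized_argmin_subgradient[OF rmda_path_Suc(2)[OF path] rmda_alpha_pos[OF \<eta>]]) auto
  have "\<forall>\<^sub>F n in sequentially. Wt (Suc n) \<in> M"
  proof (rule partly_smooth_identification[OF ps _ ri LIMSEQ_Suc[OF Wt] LIMSEQ_Suc[OF u] sub])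
    show "prox_regular_at_for \<psi> x (- v)" using pr vS by (simp add: prox_regular_at_def)
    \<comment> \<open>Subdifferential continuity turns convergence of points and subgradients into
      convergence of values.\<close>
    show "(\<lambda>n. \<psi> (Wt (Suc n))) \<longlonglongrightarrow> \<psi> x"
      using sc[unfolded subdiff_continuous_at_def, rule_format, of "\<lambda>n. Wt (Suc n)" "- v" "\<lambda>n. u (Suc n)"]
        LIMSEQ_Suc[OF Wt] LIMSEQ_Suc[OF u] sub vS by simp
  qed
  then obtain n0 where "\<forall>n\<ge>n0. Wt (Suc n) \<in> M" by (auto simp: eventually_sequentially)
  then have "\<forall>t\<ge>Suc n0. Wt t \<in> M" by (metis Suc_le_D Suc_le_mono)
  then show ?thesis by blast
qed

section \<open>Filtration of the algorithm and almost sure convergence of its noise series\<close>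

lemma measurable_ident_sets_subset:
  assumes f: "(\<lambda>x. x) \<in> N \<rightarrow>\<^sub>M M" and "space M = space N"
  shows "sets M \<subseteq> sets N"
proof
  fix A assume A: "A \<in> sets M"
  then have "(\<lambda>x. x) -` A \<inter> space N = A" using sets.sets_into_space assms(2) by fastforce
  then show "A \<in> sets N" using measurable_sets[OF f A] by simp
qed

lemma rmda_noise_convergent:
  fixes G :: "'w \<Rightarrow> 'a::euclidean_space \<Rightarrow> 'a" and Wt W :: "nat \<Rightarrow> 's \<Rightarrow> 'a"
  assumes P: "prob_space P"
    and Wt: "\<forall>t\<ge>1. Wt t \<in> borel_measurable P" and fresh: "fresh_samples P D \<xi> Wt"
    and W0: "\<And>\<omega>. \<omega> \<in> space P \<Longrightarrow> W 0 \<omega> = W0"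
    and W: "\<And>n \<omega>. \<omega> \<in> space P \<Longrightarrow> W (Suc n) \<omega> = (1 - c (Suc n)) *\<^sub>R W n \<omega> + c (Suc n) *\<^sub>R Wt (Suc n) \<omega>"
    and G: "(\<lambda>(\<zeta>, X). G \<zeta> X) \<in> borel_measurable (D \<Otimes>\<^sub>M borel)"
    and g: "\<And>X. integrable D (\<lambda>\<zeta>. G \<zeta> X)" "g \<in> borel_measurable borel" "\<And>X. g X = (\<integral>\<zeta>. G \<zeta> X \<partial>D)"
    and C: "C \<ge> 0" "\<And>k. AE \<omega> in P. (\<integral>\<^sup>+ \<zeta>. ennreal ((norm (G \<zeta> (W k \<omega>)))\<^sup>2) \<partial>D) \<le> ennreal C"
    and a: "summable (\<lambda>k. (a k)\<^sup>2)"
  shows "AE \<omega> in P. convergent (\<lambda>n. \<Sum>k<n. a k *\<^sub>R (G (\<xi> (Suc k) \<omega>) (W k \<omega>) - g (W k \<omega>)))"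
proof -
  interpret prob_space P by fact
  \<comment> \<open>The first \<open>k\<close> samples and subproblem solutions. The range
    \<open>{1..<Suc k}\<close> is the past of step \<open>Suc k\<close>, so
    \<open>\<xi> (Suc k)\<close> is independent of \<open>F k\<close> while \<open>W k\<close> is
    \<open>F k\<close>-measurable.\<close>
  define p where "p k = (\<lambda>\<omega>. \<lambda>j\<in>{1..<Suc k}. (\<xi> j \<omega>, Wt j \<omega>))" for k
  define T where "T k = PiM {1..<Suc k} (\<lambda>_. D \<Otimes>\<^sub>M (borel :: 'a measure))" for k :: nat
  define F where "F k = vimage_algebra (space P) (p k) (T k)" for k
  have \<xi>: "\<xi> (Suc k) \<in> P \<rightarrow>\<^sub>M D" and dist: "distr P D (\<xi> (Suc k)) = D"
    and ind: "indep_set (sets (vimage_algebra (space P) (\<xi> (Suc k)) D)) (sets (F k))" for k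
    using fresh[unfolded fresh_samples_def, rule_format, of "Suc k"] by (simp_all add: F_def p_def T_def)
  have sp: "space (F k) = space P" for k by (simp add: F_def)
  have p: "p k \<in> P \<rightarrow>\<^sub>M T k" for k
    unfolding p_def T_def
  proof (rule measurable_restrict)
    fix j assume "j \<in> {1..<Suc k}"
    then obtain i where "j = Suc i" by (cases j) auto
    then show "(\<lambda>\<omega>. (\<xi> j \<omega>, Wt j \<omega>)) \<in> P \<rightarrow>\<^sub>M D \<Otimes>\<^sub>M borel"
      using \<xi>[of i] Wt by (intro measurable_Pair) simp_all
  qed
  have pF: "p k \<in> F k \<rightarrow>\<^sub>M T k" for k
    unfolding F_def using measurable_space[OF p] by (intro measurable_vimage_algebra1) auto
  have comp: "(\<lambda>\<omega>. (\<xi> (Suc j) \<omega>, Wt (Suc j) \<omega>)) \<in> F k \<rightarrow>\<^sub>M D \<Otimes>\<^sub>M borel" if "j < k" for j k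
  proof -
    have "(\<lambda>\<omega>. p k \<omega> (Suc j)) \<in> F k \<rightarrow>\<^sub>M D \<Otimes>\<^sub>M borel"
      using that by (intro measurable_compose[OF pF[unfolded T_def] measurable_component_singleton]) simp
    then show ?thesis using that by (simp add: p_def)
  qed
  have \<xi>F: "\<xi> (Suc j) \<in> F k \<rightarrow>\<^sub>M D" and WtF: "Wt (Suc j) \<in> borel_measurable (F k)" if "j < k" for j k
    using measurable_compose[OF comp[OF that] measurable_fst] measurable_compose[OF comp[OF that] measurable_snd]
    by simp_all
  have mono: "sets (F j) \<subseteq> sets (F k)" if "j \<le> k" for j k
  proof -
    have "p j \<in> F k \<rightarrow>\<^sub>M T j"
      unfolding p_def T_def
    proof (rule measurable_restrict)
      fix i assume "i \<in> {1..<Suc j}"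
      moreover from this obtain i' where "i = Suc i'" by (cases i) auto
      ultimately have "i = Suc i'" "i' < k" using that by auto
      then show "(\<lambda>\<omega>. (\<xi> i \<omega>, Wt i \<omega>)) \<in> F k \<rightarrow>\<^sub>M D \<Otimes>\<^sub>M borel" using comp by simp
    qed
    then have "(\<lambda>\<omega>. \<omega>) \<in> F k \<rightarrow>\<^sub>M F j"
      unfolding F_def[of j] by (intro measurable_vimage_algebra2) (auto simp: sp)
    then show ?thesis by (rule measurable_ident_sets_subset) (simp add: sp)
  qed
  have sub: "sets (F k) \<subseteq> sets P" for k
  proof -
    have "(\<lambda>\<omega>. \<omega>) \<in> P \<rightarrow>\<^sub>M F k"
      unfolding F_def by (intro measurable_vimage_algebra2) (auto simp: p)
    then show ?thesis by (rule measurable_ident_sets_subset) (simp add: sp)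
  qed
  \<comment> \<open>Measurability of the iterates comes from their recursion, which combines the
    constant \<open>W0\<close> with the first \<open>m\<close> subproblem solutions; the recursion
    is known on \<open>space P\<close> only, hence the congruence rule.\<close>
  have WF: "W m \<in> borel_measurable (F k)" if "m \<le> k" for m k
    using that
  proof (induction m)
    case 0
    have "W 0 \<in> borel_measurable (F k) \<longleftrightarrow> (\<lambda>\<omega>. W0) \<in> borel_measurable (F k)"
      by (rule measurable_cong) (simp add: sp W0)
    then show ?case by simp
  next
    case (Suc m)
    then have [measurable]: "W m \<in> borel_measurable (F k)" "Wt (Suc m) \<in> borel_measurable (F k)"
      using WtF by auto
    have "W (Suc m) \<in> borel_measurable (F k) \<longleftrightarrow>
        (\<lambda>\<omega>. (1 - c (Suc m)) *\<^sub>R W m \<omega> + c (Suc m) *\<^sub>R Wt (Suc m) \<omega>) \<in> borel_measurable (F k)"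
      by (rule measurable_cong) (simp add: sp W)
    then show ?case by simp
  qed
  have indep: "\<forall>A\<in>sets D. \<forall>B\<in>sets (F k).
      prob (\<xi> (Suc k) -` A \<inter> space P \<inter> B) = prob (\<xi> (Suc k) -` A \<inter> space P) * prob B" for k
    using indep_setD[OF ind in_vimage_algebra] by blast
  define \<delta> where "\<delta> k \<omega> = G (\<xi> (Suc k) \<omega>) (W k \<omega>) - g (W k \<omega>)" for k \<omega>
  have "AE \<omega> in P. convergent (\<lambda>n. \<Sum>k<n. a k *\<^sub>R \<delta> k \<omega>)"
  proof (rule martingale_transform_L2_convergent[where F = F and K = C and \<delta> = \<delta> and a = a, OF sp mono sub _ _ _ _ a])
    fix k
    note noise = fresh_sample_noise[where G = G and g = g, OF sp sub \<xi> dist indep WF[OF order_refl] G g C, folded \<delta>_def]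
    show "integrable P (\<lambda>\<omega>. (norm (\<delta> k \<omega>))\<^sup>2)" "expectation (\<lambda>\<omega>. (norm (\<delta> k \<omega>))\<^sup>2) \<le> C"
      by (rule noise)+
    show "expectation (\<lambda>\<omega>. Y \<omega> \<bullet> \<delta> k \<omega>) = 0"
      if "Y \<in> borel_measurable (F k)" "integrable P (\<lambda>\<omega>. (norm (Y \<omega>))\<^sup>2)" for Y
      by (rule noise(3)[OF that])
    have [measurable]: "W k \<in> borel_measurable (F (Suc k))" "\<xi> (Suc k) \<in> F (Suc k) \<rightarrow>\<^sub>M D"
      using WF \<xi>F by auto
    have "(\<lambda>\<omega>. G (\<xi> (Suc k) \<omega>) (W k \<omega>)) \<in> borel_measurable (F (Suc k))"
      using measurable_compose[OF _ G, of "\<lambda>\<omega>. (\<xi> (Suc k) \<omega>, W k \<omega>)" "F (Suc k)"] by simp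
    then show "\<delta> k \<in> borel_measurable (F (Suc k))"
      unfolding \<delta>_def using g(2) by measurable
  qed
  then show ?thesis by (simp add: \<delta>_def)
qed

theorem theorem2:
  fixes D :: "'w measure"
    and f :: "'w \<Rightarrow> 'a::euclidean_space \<Rightarrow> real"
    and \<psi> :: "'a \<Rightarrow> ereal"
    and P :: "'s measure"
    and \<xi> :: "nat \<Rightarrow> 's \<Rightarrow> 'w"
    and V Wt W :: "nat \<Rightarrow> 's \<Rightarrow> 'a"
    and W0 Wstar :: 'a
    and \<eta> c :: "nat \<Rightarrow> real"
    and \<M> :: "'a set"
  defines "event \<equiv> {\<omega> \<in> space P. (\<lambda>t. Wt t \<omega>) \<longlonglongrightarrow> Wstar}"
  assumes "prob_space D"
    and "\<forall>\<zeta>\<in>space D. AE X in lborel. f \<zeta> differentiable (at X)"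
    and "\<forall>X. integrable D (\<lambda>\<zeta>. f \<zeta> X)"
    and "\<forall>X. \<psi> X \<noteq> -\<infinity>"
    and "\<forall>t\<ge>1. 0 < \<eta> t"
    and "\<forall>t\<ge>1. 0 \<le> c t \<and> c t \<le> 1"
    and "prob_space P"
    and "\<forall>t\<ge>1. Wt t \<in> borel_measurable P"
    and "fresh_samples P D \<xi> Wt"
    and "\<forall>\<omega>\<in>space P.
           rmda_path f \<psi> W0 \<eta> c (\<lambda>t. \<xi> t \<omega>) (\<lambda>t. V t \<omega>) (\<lambda>t. Wt t \<omega>) (\<lambda>t. W t \<omega>)"
    and i: "filterlim (\<lambda>n. \<Sum>t=1..n. c t) at_top sequentially"
    and ii: "\<exists>L. AE \<zeta> in D.
           (\<forall>X. f \<zeta> differentiable (at X)) \<and> L-lipschitz_on UNIV (gradient (f \<zeta>))"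
    and iii: "\<exists>C\<ge>0. AE \<omega> in P. \<forall>t\<ge>1.
           (\<integral>\<^sup>+ \<zeta>. ennreal ((norm (gradient (f \<zeta>) (W (t - 1) \<omega>)))\<^sup>2) \<partial>D) \<le> ennreal C"
    and iv: "filterlim (\<lambda>n. \<Sum>t=1..n. rmda_ratio \<eta> t) at_top sequentially"
            "summable (\<lambda>t. (rmda_ratio \<eta> (Suc t))\<^sup>2)"
            "AE \<omega> in P. (\<lambda>t. norm (W (t + 1) \<omega> - W t \<omega>) * inverse (rmda_ratio \<eta> t)) \<longlonglongrightarrow> 0"
    and v: "{X. 0 \<in> frechet_subdiff (\<lambda>Y. ereal (expected_loss D f Y) + \<psi> Y) X} \<noteq> {}"
    and vi: "(\<lambda>t. rmda_beta t * inverse (rmda_alpha \<eta> t)) \<longlonglongrightarrow> 0"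
    and "measure P event \<noteq> 0"
    and "prox_regular_at \<psi> Wstar"
    and "subdiff_continuous_at \<psi> Wstar"
    and "partly_smooth \<psi> \<M> Wstar"
    and "outer_semicontinuous_rel (frechet_subdiff \<psi>) UNIV Wstar"
    and "- gradient (expected_loss D f) Wstar \<in> rel_interior (frechet_subdiff \<psi> Wstar)"
  shows "AE \<omega> in uniform_measure P event. \<exists>T0. \<forall>t\<ge>T0. Wt t \<omega> \<in> \<M>"
proof -
  interpret D: prob_space D by fact
  interpret P: prob_space P by fact
  have path: "rmda_path f \<psi> W0 \<eta> c (\<lambda>t. \<xi> t \<omega>) (\<lambda>t. V t \<omega>) (\<lambda>t. Wt t \<omega>) (\<lambda>t. W t \<omega>)"
    if "\<omega> \<in> space P" for \<omega> using assms(11) that by blast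
  obtain L where "AE \<zeta> in D. (\<forall>X. f \<zeta> differentiable (at X)) \<and> L-lipschitz_on UNIV (gradient (f \<zeta>))"
    using ii by blast
  then obtain N where N: "{\<zeta>\<in>space D. \<not> ((\<forall>X. f \<zeta> differentiable (at X)) \<and> L-lipschitz_on UNIV (gradient (f \<zeta>)))} \<subseteq> N"
    "N \<in> null_sets D" unfolding eventually_ae_filter by blast
  obtain C where C: "C \<ge> 0" and AE_C: "AE \<omega> in P. \<forall>t\<ge>1.
      (\<integral>\<^sup>+ \<zeta>. ennreal ((norm (gradient (f \<zeta>) (W (t - 1) \<omega>)))\<^sup>2) \<partial>D) \<le> ennreal C"
    using iii by blast
  define A where "A = space D - N"
  have A: "A \<in> sets D" using N(2) by (auto simp: A_def)
  have AE_A: "AE \<zeta> in D. \<zeta> \<in> A"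
    using AE_not_in[OF N(2)] AE_space by eventually_elim (simp add: A_def)
  have good: "f \<zeta> differentiable (at X)" "L-lipschitz_on UNIV (gradient (f \<zeta>))" if "\<zeta> \<in> A" for \<zeta> X
    using N(1) that by (auto simp: A_def)
  \<comment> \<open>On the null set of bad samples the gradient is replaced by 0: \<open>gradient (f \<zeta>)\<close> need not be
    measurable in \<open>\<zeta>\<close> there.\<close>
  define G where "G \<zeta> X = (if \<zeta> \<in> A then gradient (f \<zeta>) X else 0)" for \<zeta> X
  \<comment> \<open>A set of full probability contains a sample, and its Lipschitz gradient
    certifies that \<open>L\<close> is nonnegative.\<close>
  have "A \<noteq> {}" using AE_A D.AE_const[of False] by fastforce
  then have L0: "0 \<le> L" using good(2) lipschitz_on_nonneg by blast
  have GL: "L-lipschitz_on UNIV (G \<zeta>)" for \<zeta>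
    using good(2)[of \<zeta>] L0 by (cases "\<zeta> \<in> A") (simp_all add: G_def[abs_def] lipschitz_on_def)
  have Gder: "AE \<zeta> in D. \<forall>X. GDERIV (f \<zeta>) X :> G \<zeta> X"
    using AE_A by eventually_elim (simp add: G_def differentiable_imp_gderiv_gradient good(1))
  have fm: "(\<lambda>\<zeta>. f \<zeta> X) \<in> borel_measurable D" for X
    using assms(4) by (simp add: borel_measurable_integrable)
  \<comment> \<open>The loss is set to 0 off \<open>A\<close> as well, so that
    \<open>G \<zeta>\<close> is its gradient at every \<open>\<zeta>\<close>, as the pointwise limit
    of difference quotients demands.\<close>
  have Gm: "(\<lambda>\<zeta>. G \<zeta> X) \<in> borel_measurable D" for X
  proof (rule gderiv_borel_measurable[where f = "\<lambda>\<zeta> X. if \<zeta> \<in> A then f \<zeta> X else 0" and X = X])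
    show "(\<lambda>\<zeta>. if \<zeta> \<in> A then f \<zeta> Y else 0) \<in> borel_measurable D" for Y
      using fm A by (intro measurable_If_set) auto
    show "GDERIV (\<lambda>X. if \<zeta> \<in> A then f \<zeta> X else 0) X :> G \<zeta> X" for \<zeta>
      by (cases "\<zeta> \<in> A") (simp_all add: G_def differentiable_imp_gderiv_gradient good(1) GDERIV_const)
  qed
  have Gpair: "(\<lambda>(\<zeta>, X). G \<zeta> X) \<in> borel_measurable (D \<Otimes>\<^sub>M borel)"
    by (rule caratheodory_borel_measurable[OF Gm lipschitz_on_continuous_on[OF GL]])
  have CG: "AE \<omega> in P. (\<integral>\<^sup>+ \<zeta>. ennreal ((norm (G \<zeta> (W k \<omega>)))\<^sup>2) \<partial>D) \<le> ennreal C" for k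
    using AE_C
  proof eventually_elim
    case (elim \<omega>)
    have "(\<integral>\<^sup>+ \<zeta>. ennreal ((norm (G \<zeta> (W k \<omega>)))\<^sup>2) \<partial>D)
        = (\<integral>\<^sup>+ \<zeta>. ennreal ((norm (gradient (f \<zeta>) (W k \<omega>)))\<^sup>2) \<partial>D)"
      by (rule nn_integral_cong_AE) (use AE_A in eventually_elim, simp add: G_def)
    then show ?case using elim[rule_format, of "Suc k"] by simp
  qed
  have Gint: "integrable D (\<lambda>\<zeta>. G \<zeta> X)" for X
  proof -
    \<comment> \<open>The starting point is deterministic, so the almost sure bound at the first
      step is an ordinary bound at \<open>W0\<close>; the Lipschitz property then carries
      integrability to every \<open>X\<close>.\<close>
    have "AE \<omega> in P. (\<integral>\<^sup>+ \<zeta>. ennreal ((norm (G \<zeta> W0))\<^sup>2) \<partial>D) \<le> ennreal C"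
      using CG[of 0] AE_space
    proof eventually_elim
      case (elim \<omega>)
      then show ?case using path[of \<omega>] by (simp add: rmda_path_def)
    qed
    then have "(\<integral>\<^sup>+ \<zeta>. ennreal ((norm (G \<zeta> W0))\<^sup>2) \<partial>D) \<le> ennreal C" by simp
    then have "integrable D (\<lambda>\<zeta>. (norm (G \<zeta> W0))\<^sup>2)"
      using Gm by (intro integrableI_bounded) (auto intro: le_less_trans)
    then have i: "integrable D (\<lambda>\<zeta>. 1 + (norm (G \<zeta> W0))\<^sup>2 + L * norm (X - W0))" by simp
    show ?thesis
    proof (rule Bochner_Integration.integrable_bound[OF i Gm AE_I2])
      fix \<zeta>
      have "norm (G \<zeta> X) \<le> norm (G \<zeta> W0) + norm (G \<zeta> X - G \<zeta> W0)"
        by (rule norm_triangle_sub)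
      also have "norm (G \<zeta> X - G \<zeta> W0) \<le> L * norm (X - W0)"
        using lipschitz_onD[OF GL, of X W0] by (simp add: dist_norm)
      also have "norm (G \<zeta> W0) \<le> 1 + (norm (G \<zeta> W0))\<^sup>2"
        using sum_squares_bound[of 1 "norm (G \<zeta> W0)", simplified] norm_ge_zero[of "G \<zeta> W0"] by linarith
      finally show "norm (G \<zeta> X) \<le> norm (1 + (norm (G \<zeta> W0))\<^sup>2 + L * norm (X - W0))" by simp
    qed
  qed
  define g where "g X = (\<integral>\<zeta>. G \<zeta> X \<partial>D)" for X
  have gL: "L-lipschitz_on UNIV g"
  proof (rule lipschitz_onI[OF _ L0])
    fix X Y
    have "norm (g X - g Y) \<le> (\<integral>\<zeta>. norm (G \<zeta> X - G \<zeta> Y) \<partial>D)"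
      using integral_norm_bound[of D "\<lambda>\<zeta>. G \<zeta> X - G \<zeta> Y"] by (simp add: g_def Gint)
    also have "\<dots> \<le> (\<integral>\<zeta>. L * dist X Y \<partial>D)"
      using Gint lipschitz_onD[OF GL, of X Y]
      by (intro integral_mono integrable_norm Bochner_Integration.integrable_diff) (auto simp: dist_norm)
    finally show "dist (g X) (g Y) \<le> L * dist X Y" by (simp add: dist_norm D.prob_space)
  qed
  have gcont: "continuous_on UNIV g" by (rule lipschitz_on_continuous_on[OF gL])
  have grad: "gradient (expected_loss D f) Wstar = g Wstar"
    unfolding g_def using assms(2,4) Gder GL Gint by (intro gradient_eqI expected_loss_gderiv) auto
  have fresh: "\<xi> (Suc k) \<in> P \<rightarrow>\<^sub>M D" "distr P D (\<xi> (Suc k)) = D" for k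
    using assms(10)[unfolded fresh_samples_def, rule_format, of "Suc k"] by simp_all
  have "AE \<omega> in P. convergent (\<lambda>n. \<Sum>k<n. rmda_ratio \<eta> (Suc k) *\<^sub>R (G (\<xi> (Suc k) \<omega>) (W k \<omega>) - g (W k \<omega>)))"
  proof (rule rmda_noise_convergent[OF assms(8-10) _ _ Gpair Gint _ g_def C CG iv(2)])
    show "W 0 \<omega> = W0" if "\<omega> \<in> space P" for \<omega>
      using path[OF that] by (simp add: rmda_path_def)
    show "W (Suc n) \<omega> = (1 - c (Suc n)) *\<^sub>R W n \<omega> + c (Suc n) *\<^sub>R Wt (Suc n) \<omega>" if "\<omega> \<in> space P" for n \<omega>
      by (rule rmda_path_Suc(3)[OF path[OF that]])
    show "g \<in> borel_measurable borel" by (rule borel_measurable_continuous_onI[OF gcont])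
  qed
  \<comment> \<open>Every sample has law \<open>D\<close>, so almost surely all of the countably
    many samples are good, and \<open>G\<close> is the true gradient along the path.\<close>
  moreover have "AE \<omega> in P. \<forall>k. \<xi> (Suc k) \<omega> \<in> A"
    unfolding AE_all_countable
  proof
    fix k
    have "AE \<zeta> in distr P D (\<xi> (Suc k)). \<zeta> \<in> A" unfolding fresh(2) by (rule AE_A)
    then show "AE \<omega> in P. \<xi> (Suc k) \<omega> \<in> A" by (rule AE_distrD[OF fresh(1)])
  qed
  ultimately have "AE \<omega> in P. \<omega> \<in> event \<longrightarrow> (\<exists>T0. \<forall>t\<ge>T0. Wt t \<omega> \<in> \<M>)"
    using AE_space
  proof eventually_elim
    case (elim \<omega>)
    show ?case
    proof
      assume "\<omega> \<in> event"
      then have Wt: "(\<lambda>t. Wt t \<omega>) \<longlonglongrightarrow> Wstar" by (simp add: event_def)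
      note p = path[OF elim(3)]
      have W: "(\<lambda>t. W t \<omega>) \<longlonglongrightarrow> Wstar" by (rule rmda_iterates_tendsto[OF p assms(7) i Wt])
      have "(\<lambda>t. V t \<omega> /\<^sub>R rmda_alpha \<eta> t) \<longlonglongrightarrow> g Wstar"
      proof (rule rmda_dual_average_tendsto[OF p assms(6) iv(1) _ W])
        show "convergent (\<lambda>n. \<Sum>k<n. rmda_ratio \<eta> (Suc k) *\<^sub>R (gradient (f (\<xi> (Suc k) \<omega>)) (W k \<omega>) - g (W k \<omega>)))"
          using elim(1,2) by (simp add: G_def)
        show "isCont g Wstar" using gcont by (simp add: continuous_on_eq_continuous_at)
      qed
      then show "\<exists>T0. \<forall>t\<ge>T0. Wt t \<omega> \<in> \<M>"
        using assms unfolding grad by (intro rmda_path_identification[OF p assms(5,6) _ vi Wt]) auto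
    qed
  qed
  \<comment> \<open>A set outside the sigma-algebra has \<open>measure\<close> 0 by convention, so
    nonzero probability yields measurability of the event.\<close>
  moreover have "event \<in> sets P"
    using \<open>measure P event \<noteq> 0\<close> measure_notin_sets by blast
  ultimately show ?thesis by (intro AE_uniform_measureI)
qed

end
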